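(* Let $(X,R)$ be a finite presentation of a category such that the presented category $\langle X\mid R\rangle$ is residually finite. Then the word problem for $(X,R)$ is solvable.
   Context: A quiver is a quadruple $(V,E,s,t)$ of a set $V$ of vertices, a set $E$ of edges, and maps $s,t\colon E\to V$ (source and target); it is finite if $V$ and $E$ are finite. The free category $F_X$ on a quiver $X$ has the vertices as objects and the finite directed paths (including an empty path at each vertex) as morphisms, with concatenation as composition. A finite presentation of a category is a pair $(X,R)$ consisting of a finite quiver $X$ and a finite set $R$ of pairs $(p,q)$ of finite directed paths in $X$, where $p$ and $q$ have the same start vertex and the same end vertex. The category $\langle X\mid R\rangle$ presented by $(X,R)$ is the quotient category of $F_X$ by the smallest congruence relation on morphisms of $F_X$ containing $R$ (a congruence relation is an equivalence relation on each morphism set, compatible with composition). The word problem for $(X,R)$ is solvable if there exists an algorithm that, given as input two finite directed paths in $X$ (specified as finite lists of directed edges), decides whether the morphisms of $\langle X\mid R\rangle$ represented by these paths are equal or not. A category $D$ is finite if its collection of objects is finite and all sets $\mathrm{Mor}_D(X,Y)$ are finite. Two morphisms $f\in \mathrm{Mor}_C(X,Y)$, $g\in\mathrm{Mor}_C(X',Y')$ of a category $C$ are considered equal if and only if $X=X'$, $Y=Y'$ and $f=g$. A category $C$ is residually finite if for all morphisms $f,g$ in $C$ with $f\neq g$ there exist a finite category $D$ and a functor $F\colon C\to D$ with $F(f)\neq F(g)$. *)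

theory Defs
  imports "Graph_Theory.Arc_Walk" "HOL-Library.Nat_Bijection"
begin

section \<open>Categories, functors, congruences\<close>

text \<open>
  The sets of morphisms between different pairs of objects need not be disjoint, so identities and
  composition carry their objects as arguments. Composition is written in diagrammatic order:
  \<^term>\<open>Cmp C X Y Z f g\<close> is the composite of \<open>f : X \<rightarrow> Y\<close> followed by \<open>g : Y \<rightarrow> Z\<close>.
\<close>

record ('o, 'm) cat =
  Obj :: "'o set"
  Mor :: "'o \<Rightarrow> 'o \<Rightarrow> 'm set"
  Idt :: "'o \<Rightarrow> 'm"
  Cmp :: "'o \<Rightarrow> 'o \<Rightarrow> 'o \<Rightarrow> 'm \<Rightarrow> 'm \<Rightarrow> 'm"

locale category =
  fixes C :: "('o, 'm) cat"
  assumes Idt_in_Mor: "X \<in> Obj C \<Longrightarrow> Idt C X \<in> Mor C X X"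
    and Cmp_in_Mor: "\<lbrakk>X \<in> Obj C; Y \<in> Obj C; Z \<in> Obj C; f \<in> Mor C X Y; g \<in> Mor C Y Z\<rbrakk>
      \<Longrightarrow> Cmp C X Y Z f g \<in> Mor C X Z"
    and Cmp_Idt_left: "\<lbrakk>X \<in> Obj C; Y \<in> Obj C; f \<in> Mor C X Y\<rbrakk> \<Longrightarrow> Cmp C X X Y (Idt C X) f = f"
    and Cmp_Idt_right: "\<lbrakk>X \<in> Obj C; Y \<in> Obj C; f \<in> Mor C X Y\<rbrakk> \<Longrightarrow> Cmp C X Y Y f (Idt C Y) = f"
    and Cmp_assoc: "\<lbrakk>W \<in> Obj C; X \<in> Obj C; Y \<in> Obj C; Z \<in> Obj C;
        f \<in> Mor C W X; g \<in> Mor C X Y; h \<in> Mor C Y Z\<rbrakk>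
      \<Longrightarrow> Cmp C W Y Z (Cmp C W X Y f g) h = Cmp C W X Z f (Cmp C X Y Z g h)"

locale finite_category = category +
  assumes finite_Obj: "finite (Obj C)"
    and finite_Mor: "\<lbrakk>X \<in> Obj C; Y \<in> Obj C\<rbrakk> \<Longrightarrow> finite (Mor C X Y)"

text \<open>
  An arrow is a morphism together with its domain and codomain; equality of arrows is equality of
  morphisms of the category (same domain, same codomain, same element of the morphism set).
\<close>

definition arrows :: "('o, 'm) cat \<Rightarrow> ('o \<times> 'm \<times> 'o) set" where
  "arrows C = {(X, f, Y). X \<in> Obj C \<and> Y \<in> Obj C \<and> f \<in> Mor C X Y}"

locale cat_functor = C: category C + D: category D
  for C :: "('o, 'm) cat" and D :: "('p, 'n) cat"
    and Fo :: "'o \<Rightarrow> 'p" and Fm :: "'o \<Rightarrow> 'o \<Rightarrow> 'm \<Rightarrow> 'n" +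
  assumes Fo_in_Obj: "X \<in> Obj C \<Longrightarrow> Fo X \<in> Obj D"
    and Fm_in_Mor: "\<lbrakk>X \<in> Obj C; Y \<in> Obj C; f \<in> Mor C X Y\<rbrakk> \<Longrightarrow> Fm X Y f \<in> Mor D (Fo X) (Fo Y)"
    and Fm_Idt: "X \<in> Obj C \<Longrightarrow> Fm X X (Idt C X) = Idt D (Fo X)"
    and Fm_Cmp: "\<lbrakk>X \<in> Obj C; Y \<in> Obj C; Z \<in> Obj C; f \<in> Mor C X Y; g \<in> Mor C Y Z\<rbrakk>
      \<Longrightarrow> Fm X Z (Cmp C X Y Z f g) = Cmp D (Fo X) (Fo Y) (Fo Z) (Fm X Y f) (Fm Y Z g)"

fun map_arrow :: "('o \<Rightarrow> 'p) \<Rightarrow> ('o \<Rightarrow> 'o \<Rightarrow> 'm \<Rightarrow> 'n) \<Rightarrow> 'o \<times> 'm \<times> 'o \<Rightarrow> 'p \<times> 'n \<times> 'p" where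
  "map_arrow Fo Fm (X, f, Y) = (Fo X, Fm X Y f, Fo Y)"

text \<open>
  HOL cannot quantify over types inside a definition, so the finite category \<open>D\<close> has natural numbers
  as objects and morphisms. This is no restriction, since every finite category is isomorphic to
  one of this form; see \<open>separated_imp_nat_separated\<close> below.
\<close>

definition residually_finite :: "('o, 'm) cat \<Rightarrow> bool" where
  "residually_finite C \<longleftrightarrow> category C \<and>
     (\<forall>f \<in> arrows C. \<forall>g \<in> arrows C. f \<noteq> g \<longrightarrow>
       (\<exists>(D :: (nat, nat) cat) Fo Fm. finite_category D \<and> cat_functor C D Fo Fm \<and>
          map_arrow Fo Fm f \<noteq> map_arrow Fo Fm g))"

lemma separated_imp_nat_separated:
  fixes C :: "('o, 'm) cat" and D :: "('p, 'n) cat"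
  assumes fin: "finite_category D" and func: "cat_functor C D Fo Fm"
    and f: "f \<in> arrows C" and g: "g \<in> arrows C"
    and ne: "map_arrow Fo Fm f \<noteq> map_arrow Fo Fm g"
  shows "\<exists>(D' :: (nat, nat) cat) Go Gm. finite_category D' \<and> cat_functor C D' Go Gm \<and>
           map_arrow Go Gm f \<noteq> map_arrow Go Gm g"
proof -
  interpret D: finite_category D by (fact fin)
  interpret F: cat_functor C D Fo Fm by (fact func)
  define M where "M = (\<Union>X\<in>Obj D. \<Union>Y\<in>Obj D. Mor D X Y)"
  have "finite M"
    unfolding M_def using D.finite_Obj D.finite_Mor by auto
  then obtain k :: "'n \<Rightarrow> nat" where k: "inj_on k M"
    using finite_imp_inj_to_nat_seg by metis
  obtain i :: "'p \<Rightarrow> nat" where i: "inj_on i (Obj D)"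
    using finite_imp_inj_to_nat_seg D.finite_Obj by metis
  define i' where "i' = inv_into (Obj D) i"
  define k' where "k' = inv_into M k"
  have ii: "i' (i X) = X" if "X \<in> Obj D" for X
    using that i by (simp add: i'_def)
  have kk: "k' (k a) = a" if "X \<in> Obj D" "Y \<in> Obj D" "a \<in> Mor D X Y" for X Y a
    using that k unfolding k'_def by (intro inv_into_f_f) (auto simp: M_def)
  define D' :: "(nat, nat) cat" where
    "D' = \<lparr>Obj = i ` Obj D, Mor = (\<lambda>a b. k ` Mor D (i' a) (i' b)),
           Idt = (\<lambda>a. k (Idt D (i' a))),
           Cmp = (\<lambda>a b c x y. k (Cmp D (i' a) (i' b) (i' c) (k' x) (k' y)))\<rparr>"
  have D': "category D'"
    by unfold_locales
      (auto simp: D'_def ii kk D.Idt_in_Mor D.Cmp_in_Mor D.Cmp_Idt_left D.Cmp_Idt_right D.Cmp_assoc)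
  then have fin': "finite_category D'"
    by (auto simp: finite_category_def finite_category_axioms_def D'_def ii D.finite_Obj D.finite_Mor)
  interpret D': category D' by (fact D')
  have func': "cat_functor C D' (\<lambda>X. i (Fo X)) (\<lambda>X Y a. k (Fm X Y a))"
    by unfold_locales
      (auto simp: D'_def ii kk[OF F.Fo_in_Obj F.Fo_in_Obj F.Fm_in_Mor]
         F.Fo_in_Obj F.Fm_in_Mor F.Fm_Idt F.Fm_Cmp)
  obtain X a Y where fe: "f = (X, a, Y)" "X \<in> Obj C" "Y \<in> Obj C" "a \<in> Mor C X Y"
    using f by (auto simp: arrows_def)
  obtain X' b Y' where ge: "g = (X', b, Y')" "X' \<in> Obj C" "Y' \<in> Obj C" "b \<in> Mor C X' Y'"
    using g by (auto simp: arrows_def)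
  have "map_arrow (\<lambda>X. i (Fo X)) (\<lambda>X Y a. k (Fm X Y a)) f
      \<noteq> map_arrow (\<lambda>X. i (Fo X)) (\<lambda>X Y a. k (Fm X Y a)) g"
    using ne fe ge ii[OF F.Fo_in_Obj] kk[OF F.Fo_in_Obj F.Fo_in_Obj F.Fm_in_Mor]
    by simp metis
  with fin' func' show ?thesis by blast
qed

definition congruence :: "('o, 'm) cat \<Rightarrow> ('o \<Rightarrow> 'o \<Rightarrow> ('m \<times> 'm) set) \<Rightarrow> bool" where
  "congruence C r \<longleftrightarrow>
     (\<forall>X \<in> Obj C. \<forall>Y \<in> Obj C. equiv (Mor C X Y) (r X Y)) \<and>
     (\<forall>X \<in> Obj C. \<forall>Y \<in> Obj C. \<forall>Z \<in> Obj C. \<forall>f f' g g'.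
        (f, f') \<in> r X Y \<longrightarrow> (g, g') \<in> r Y Z \<longrightarrow> (Cmp C X Y Z f g, Cmp C X Y Z f' g') \<in> r X Z)"

definition parallel :: "('o \<times> 'm \<times> 'o) \<times> ('o \<times> 'm \<times> 'o) \<Rightarrow> bool" where
  "parallel = (\<lambda>((X, f, Y), (X', g, Y')). X = X' \<and> Y = Y')"

definition generated_congruence ::
  "('o, 'm) cat \<Rightarrow> (('o \<times> 'm \<times> 'o) \<times> ('o \<times> 'm \<times> 'o)) set \<Rightarrow> 'o \<Rightarrow> 'o \<Rightarrow> ('m \<times> 'm) set" where
  "generated_congruence C R X Y = {(f, g). \<forall>r. congruence C r \<and>
     (\<forall>A a B A' b B'. ((A, a, B), (A', b, B')) \<in> R \<longrightarrow> (a, b) \<in> r A B) \<longrightarrow> (f, g) \<in> r X Y}"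

definition quotient_category ::
  "('o, 'm) cat \<Rightarrow> ('o \<Rightarrow> 'o \<Rightarrow> ('m \<times> 'm) set) \<Rightarrow> ('o, 'm set) cat" where
  "quotient_category C r =
     \<lparr>Obj = Obj C,
      Mor = (\<lambda>X Y. Mor C X Y // r X Y),
      Idt = (\<lambda>X. r X X `` {Idt C X}),
      Cmp = (\<lambda>X Y Z a b. \<Union>f\<in>a. \<Union>g\<in>b. r X Z `` {Cmp C X Y Z f g})\<rparr>"

fun quotient_arrow :: "('o \<Rightarrow> 'o \<Rightarrow> ('m \<times> 'm) set) \<Rightarrow> 'o \<times> 'm \<times> 'o \<Rightarrow> 'o \<times> 'm set \<times> 'o" where
  "quotient_arrow r (X, f, Y) = (X, r X Y `` {f}, Y)"

lemma quotient_category_category: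
  assumes "category C" and r: "congruence C r"
  shows "category (quotient_category C r)"
    and "cat_functor C (quotient_category C r) (\<lambda>X. X) (\<lambda>X Y f. r X Y `` {f})"
proof -
  interpret C: category C by fact
  have eq: "equiv (Mor C X Y) (r X Y)" if "X \<in> Obj C" "Y \<in> Obj C" for X Y
    using r that by (auto simp: congruence_def)
  have cmp: "(Cmp C X Y Z f g, Cmp C X Y Z f' g') \<in> r X Z"
    if "X \<in> Obj C" "Y \<in> Obj C" "Z \<in> Obj C" "(f, f') \<in> r X Y" "(g, g') \<in> r Y Z" for X Y Z f f' g g'
    using r that unfolding congruence_def by blast
  let ?Q = "quotient_category C r"
  have Cmp_class: "Cmp ?Q X Y Z (r X Y `` {f}) (r Y Z `` {g}) = r X Z `` {Cmp C X Y Z f g}"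
    if o: "X \<in> Obj C" "Y \<in> Obj C" "Z \<in> Obj C" and fg: "f \<in> Mor C X Y" "g \<in> Mor C Y Z"
    for X Y Z f g
  proof -
    have class_eq: "r X Z `` {Cmp C X Y Z f' g'} = r X Z `` {Cmp C X Y Z f g}"
      if "f' \<in> r X Y `` {f}" "g' \<in> r Y Z `` {g}" for f' g'
      using that cmp[OF o] by (intro equiv_class_eq[OF eq[OF o(1,3)], symmetric]) auto
    have "Cmp ?Q X Y Z (r X Y `` {f}) (r Y Z `` {g}) =
        (\<Union>f'\<in>r X Y `` {f}. \<Union>g'\<in>r Y Z `` {g}. r X Z `` {Cmp C X Y Z f g})"
      unfolding quotient_category_def cat.simps by (intro SUP_cong refl class_eq)
    also have "\<dots> = r X Z `` {Cmp C X Y Z f g}"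
      using equiv_class_self[OF eq[OF o(1,2)] fg(1)] equiv_class_self[OF eq[OF o(2,3)] fg(2)]
      by blast
    finally show ?thesis .
  qed
  have Mor_Q: "a \<in> Mor ?Q X Y \<longleftrightarrow> (\<exists>f \<in> Mor C X Y. a = r X Y `` {f})" for a X Y
    by (auto simp: quotient_category_def quotient_def)
  have Obj_Q: "Obj ?Q = Obj C" and Idt_Q: "Idt ?Q X = r X X `` {Idt C X}" for X
    by (auto simp: quotient_category_def)
  show Q: "category ?Q"
    by unfold_locales
      (auto simp: Mor_Q Obj_Q Idt_Q Cmp_class C.Idt_in_Mor C.Cmp_in_Mor C.Cmp_Idt_left
        C.Cmp_Idt_right C.Cmp_assoc)
  interpret Q: category ?Q by (fact Q)
  show "cat_functor C ?Q (\<lambda>X. X) (\<lambda>X Y f. r X Y `` {f})"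
    by unfold_locales (auto simp: Mor_Q Obj_Q Idt_Q Cmp_class)
qed

lemma generated_congruence_congruence:
  assumes "category C" and R: "R \<subseteq> arrows C \<times> arrows C" "\<forall>e \<in> R. parallel e"
  shows "congruence C (generated_congruence C R)"
proof -
  interpret C: category C by fact
  let ?in = "\<lambda>r. \<forall>A a B A' b B'. ((A, a, B), (A', b, B')) \<in> R \<longrightarrow> (a, b) \<in> r A B"
  have total: "congruence C (\<lambda>X Y. Mor C X Y \<times> Mor C X Y)"
    by (auto simp: congruence_def C.Cmp_in_Mor equiv_def refl_on_def sym_def trans_def)
  have total_R: "?in (\<lambda>X Y. Mor C X Y \<times> Mor C X Y)"
    using R by (fastforce simp: arrows_def parallel_def)
  have eq: "equiv (Mor C X Y) (r X Y)" if "congruence C r" "X \<in> Obj C" "Y \<in> Obj C" for r X Y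
    using that by (auto simp: congruence_def)
  have cmp: "(Cmp C X Y Z f g, Cmp C X Y Z f' g') \<in> r X Z"
    if "congruence C r" "X \<in> Obj C" "Y \<in> Obj C" "Z \<in> Obj C" "(f, f') \<in> r X Y" "(g, g') \<in> r Y Z"
    for r X Y Z f f' g g'
    using that unfolding congruence_def by blast
  have "equiv (Mor C X Y) (generated_congruence C R X Y)" if o: "X \<in> Obj C" "Y \<in> Obj C" for X Y
  proof (rule equivI)
    show "generated_congruence C R X Y \<subseteq> Mor C X Y \<times> Mor C X Y"
      using total total_R unfolding generated_congruence_def by blast
    show "refl_on (Mor C X Y) (generated_congruence C R X Y)"
      using eq[OF _ o] by (auto simp: refl_on_def generated_congruence_def equiv_def)
    show "sym (generated_congruence C R X Y)"
      using eq[OF _ o] unfolding sym_def generated_congruence_def equiv_def by blast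
    show "trans (generated_congruence C R X Y)"
      using eq[OF _ o] unfolding trans_def generated_congruence_def equiv_def by blast
  qed
  moreover have "(Cmp C X Y Z f g, Cmp C X Y Z f' g') \<in> generated_congruence C R X Z"
    if "X \<in> Obj C" "Y \<in> Obj C" "Z \<in> Obj C"
      "(f, f') \<in> generated_congruence C R X Y" "(g, g') \<in> generated_congruence C R Y Z"
    for X Y Z f f' g g'
    using that cmp unfolding generated_congruence_def by blast
  ultimately show ?thesis
    unfolding congruence_def by blast
qed


section \<open>Presented categories\<close>

text \<open>
  A quiver is a \<^typ>\<open>('v, 'e) pre_digraph\<close> satisfying \<^const>\<open>wf_digraph\<close> (source \<^const>\<open>tail\<close>, target
  \<^const>\<open>head\<close>, loops and multiple edges allowed), a finite quiver one satisfying \<^const>\<open>fin_digraph\<close>.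
  The directed paths from \<open>u\<close> to \<open>v\<close> are the arc walks \<^term>\<open>pre_digraph.awalk X u p v\<close>. The empty
  list is a walk from each vertex to itself, so a path as such is an arrow \<open>(u, p, v)\<close>.
\<close>

definition free_category :: "('v, 'e) pre_digraph \<Rightarrow> ('v, 'e list) cat" where
  "free_category X =
     \<lparr>Obj = verts X,
      Mor = (\<lambda>u v. {p. pre_digraph.awalk X u p v}),
      Idt = (\<lambda>u. []),
      Cmp = (\<lambda>u v w p q. p @ q)\<rparr>"

type_synonym ('v, 'e) path = "'v \<times> 'e list \<times> 'v"

definition finite_presentation ::
  "('v, 'e) pre_digraph \<Rightarrow> (('v, 'e) path \<times> ('v, 'e) path) set \<Rightarrow> bool" where
  "finite_presentation X R \<longleftrightarrow> fin_digraph X \<and> finite R \<and>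
     R \<subseteq> arrows (free_category X) \<times> arrows (free_category X) \<and> (\<forall>e \<in> R. parallel e)"

definition presented_category ::
  "('v, 'e) pre_digraph \<Rightarrow> (('v, 'e) path \<times> ('v, 'e) path) set \<Rightarrow> ('v, 'e list set) cat" where
  "presented_category X R =
     quotient_category (free_category X) (generated_congruence (free_category X) R)"

definition represented_arrow ::
  "('v, 'e) pre_digraph \<Rightarrow> (('v, 'e) path \<times> ('v, 'e) path) set \<Rightarrow> ('v, 'e) path
     \<Rightarrow> 'v \<times> 'e list set \<times> 'v" where
  "represented_arrow X R = quotient_arrow (generated_congruence (free_category X) R)"

lemma free_category_category:
  assumes "wf_digraph X"
  shows "category (free_category X)"
proof -
  interpret wf_digraph X by fact
  show ?thesis
    by unfold_locales (auto simp: free_category_def awalk_Nil_iff)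
qed

lemma presented_category_category:
  assumes "finite_presentation X R"
  shows "category (presented_category X R)"
  using assms unfolding presented_category_def finite_presentation_def
  by (auto intro!: quotient_category_category generated_congruence_congruence free_category_category
      simp: fin_digraph_def)


section \<open>Partial recursive functions\<close>

datatype recf =
    Zero
  | Succ
  | Proj nat
  | Comp recf "recf list"
  | PrimRec recf recf
  | Mu recf

text \<open>
  \<open>computes f xs y\<close>: the program \<open>f\<close> halts on the arguments \<open>xs\<close> with result \<open>y\<close>. The recursion
  argument of \<^const>\<open>PrimRec\<close> and the search argument of \<^const>\<open>Mu\<close> come first; in a recursion step
  they are followed by the previous value.
\<close>

inductive computes :: "recf \<Rightarrow> nat list \<Rightarrow> nat \<Rightarrow> bool" where
  Zero: "computes Zero xs 0"
| Succ: "computes Succ [x] (Suc x)"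
| Proj: "i < length xs \<Longrightarrow> computes (Proj i) xs (xs ! i)"
| Comp: "\<lbrakk>list_all2 (\<lambda>g y. computes g xs y) gs ys; computes f ys z\<rbrakk> \<Longrightarrow> computes (Comp f gs) xs z"
| PrimRec_0: "computes f xs y \<Longrightarrow> computes (PrimRec f g) (0 # xs) y"
| PrimRec_Suc: "\<lbrakk>computes (PrimRec f g) (n # xs) y; computes g (n # y # xs) z\<rbrakk>
    \<Longrightarrow> computes (PrimRec f g) (Suc n # xs) z"
| Mu: "\<lbrakk>computes f (n # xs) 0; \<forall>m < n. \<exists>k. computes f (m # xs) (Suc k)\<rbrakk> \<Longrightarrow> computes (Mu f) xs n"

lemma computes_deterministic:
  "computes f xs y \<Longrightarrow> computes f xs z \<Longrightarrow> y = z"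
proof (induction arbitrary: z rule: computes.induct)
  case (Comp xs gs ys f z')
  from Comp.prems obtain ys' where ys': "list_all2 (\<lambda>g. computes g xs) gs ys'" "computes f ys' z"
    by (auto elim: computes.cases)
  have "ys = ys'"
    using Comp.IH(1) ys'(1) by (auto simp: list_all2_conv_all_nth intro!: nth_equalityI)
  with Comp.IH(2) ys'(2) show ?case by blast
next
  case (PrimRec_0 f xs y g)
  from PrimRec_0.prems have "computes f xs z"
    by (auto elim: computes.cases)
  then show ?case by (rule PrimRec_0.IH)
next
  case (PrimRec_Suc f g n xs y z')
  from PrimRec_Suc.prems obtain y' where y': "computes (PrimRec f g) (n # xs) y'"
      "computes g (n # y' # xs) z"
    by (auto elim: computes.cases)
  with PrimRec_Suc.IH show ?case by blast
next
  case (Mu f n xs)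
  from Mu.prems have z: "computes f (z # xs) 0" "\<forall>m < z. \<exists>k. computes f (m # xs) (Suc k)"
    by (auto elim: computes.cases)
  have "\<not> n < z"
    using z(2) Mu.IH(1) by fastforce
  moreover have "\<not> z < n"
    using z(1) Mu.IH(2) by fastforce
  ultimately show ?case by simp
qed (auto elim: computes.cases)


section \<open>The word problem\<close>

text \<open>
  Paths are given to programs as numbers, relative to numberings \<open>\<nu>\<close> of the vertices and \<open>\<eta>\<close> of the
  edges: as the list of edges together with the start vertex, which the list of edges alone does
  not determine if it is empty.
\<close>

fun path_code :: "('v \<Rightarrow> nat) \<Rightarrow> ('e \<Rightarrow> nat) \<Rightarrow> ('v, 'e) path \<Rightarrow> nat" where
  "path_code \<nu> \<eta> (u, p, v) = prod_encode (\<nu> u, list_encode (map \<eta> p))"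

text \<open>
  On finite sets, any two numberings are computable from each other, so it does not matter which
  ones are used; the definition asks for an algorithm for each choice. Inputs that do not code
  directed paths are irrelevant.
\<close>

definition word_problem_solvable ::
  "('v, 'e) pre_digraph \<Rightarrow> (('v, 'e) path \<times> ('v, 'e) path) set \<Rightarrow> bool" where
  "word_problem_solvable X R \<longleftrightarrow>
     (\<forall>\<nu> \<eta>. inj_on \<nu> (verts X) \<and> inj_on \<eta> (arcs X) \<longrightarrow>
       (\<exists>alg. \<forall>p \<in> arrows (free_category X). \<forall>q \<in> arrows (free_category X).
          computes alg [path_code \<nu> \<eta> p, path_code \<nu> \<eta> q]
            (if represented_arrow X R p = represented_arrow X R q then 1 else 0)))"

end

theory Submission
  imports Defs
begin

text \<open>
  Equality in the presented category and, if that category is residually finite, inequality as well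
  are witnessed by finite data that can be checked mechanically. An algorithm enumerates all finite
  data until it meets a witness of either kind.

  Two parallel paths are equal iff one can be rewritten into the other by replacing a subpath that
  is one side of a relation by the other side; a witness is the list of the replacements
  (\<open>proves_equal_iff\<close>).

  Paths with different starts are never equal. If paths \<open>p\<close> and \<open>q\<close> from \<open>u\<close> represent different
  arrows, some functor \<open>F\<close> to a finite category \<open>D\<close> separates these arrows. Rather than enumerating
  finite categories, the algorithm enumerates finite models of the presentation: a finite set of
  states lying over the vertices and an action of the edges on it that satisfies the relations. Any model on which \<open>p\<close> and \<open>q\<close> act differently shows that they are not
  equal. Conversely \<open>w \<mapsto> Hom(F u, F w)\<close> is such a model, and from the state given by the identity of
  \<open>F u\<close> the paths \<open>p\<close> and \<open>q\<close> lead to \<open>F p\<close> and \<open>F q\<close>, as in the Yoneda lemma (\<open>functor_model\<close>). The states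
  remember their vertices, so the same model also tells apart paths with different ends.

  To turn this into a program, pairs and lists are numbered bijectively and the computable functions
  between numbered types are shown to be closed under the usual operations on such data. That the
  checkers for both kinds of witnesses are computable can then be read off their definitions. As
  every number encodes some pair of candidate witnesses, unbounded minimization performs the search
  (\<open>semidecidable_alternatives_algorithm\<close>).
\<close>

section \<open>Numbered types\<close>

text \<open>
  Bijectivity makes every number a code. A search over all data of a numbered type is then a search
  over all numbers, and programs need not test whether their input is well formed.
\<close>

class numbered =
  fixes encode :: "'a \<Rightarrow> nat"
  assumes bij_encode: "bij encode"
begin

definition decode :: "nat \<Rightarrow> 'a" where
  "decode = inv encode"

lemma encode_inject [simp]: "encode x = encode y \<longleftrightarrow> x = y"
  using bij_encode by (simp add: bij_def inj_eq)

lemma encode_decode [simp]: "encode (decode n) = n"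
  using bij_encode by (simp add: decode_def bij_def surj_f_inv_f)

lemma decode_encode [simp]: "decode (encode x) = x"
  using bij_encode by (simp add: decode_def bij_def)

end

instantiation nat :: numbered
begin
definition encode_nat :: "nat \<Rightarrow> nat" where "encode_nat n = n"
instance by standard (simp add: encode_nat_def bij_def inj_def surj_def)
end

instantiation prod :: (numbered, numbered) numbered
begin
definition encode_prod :: "'a \<times> 'b \<Rightarrow> nat" where
  "encode_prod x = prod_encode (encode (fst x), encode (snd x))"
instance
proof
  have "encode = prod_encode \<circ> map_prod (encode :: 'a \<Rightarrow> nat) (encode :: 'b \<Rightarrow> nat)"
    by (auto simp: encode_prod_def)
  moreover have "bij (map_prod (encode :: 'a \<Rightarrow> nat) (encode :: 'b \<Rightarrow> nat))"
    using bij_encode[where ?'a = 'a] bij_encode[where ?'a = 'b]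
    by (simp add: bij_def map_prod_surj prod.inj_map)
  ultimately show "bij (encode :: 'a \<times> 'b \<Rightarrow> nat)"
    using bij_prod_encode by (metis bij_comp)
qed
end

instantiation list :: (numbered) numbered
begin
definition encode_list :: "'a list \<Rightarrow> nat" where
  "encode_list xs = list_encode (map encode xs)"
instance
proof
  have "encode = list_encode \<circ> map (encode :: 'a \<Rightarrow> nat)"
    by (auto simp: encode_list_def)
  moreover have "bij (map (encode :: 'a \<Rightarrow> nat))"
    using bij_encode[where ?'a = 'a] lists_image[of "encode :: 'a \<Rightarrow> nat" UNIV]
    by (simp add: bij_def list.inj_map lists_UNIV)
  ultimately show "bij (encode :: 'a list \<Rightarrow> nat)"
    using bij_list_encode by (metis bij_comp)
qed
end

lemma encode_Nil: "encode [] = 0"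
  and encode_Cons: "encode (x # xs) = Suc (encode (x, xs))"
  by (simp_all add: encode_list_def encode_prod_def)

text \<open>This lets the code of a list serve as the number of rounds in a loop over the list.\<close>
lemma length_le_encode: "length xs \<le> encode xs"
proof (induction xs)
  case (Cons x xs)
  have "encode xs \<le> encode (x, xs)"
    by (simp add: encode_prod_def le_prod_encode_2)
  with Cons show ?case by (simp add: encode_Cons)
qed simp

section \<open>Programs for numbers and pairs\<close>

lemma computes_Comp1:
  "\<lbrakk>computes g xs y; computes f [y] z\<rbrakk> \<Longrightarrow> computes (Comp f [g]) xs z"
  by (rule computes.Comp[where ys = "[y]"]) auto

lemma computes_Comp2:
  "\<lbrakk>computes g xs y; computes g' xs y'; computes f [y, y'] z\<rbrakk> \<Longrightarrow> computes (Comp f [g, g']) xs z"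
  by (rule computes.Comp[where ys = "[y, y']"]) auto

lemma computes_Proj: "i < length xs \<Longrightarrow> y = xs ! i \<Longrightarrow> computes (Proj i) xs y"
  by (simp add: computes.Proj)

definition "add_alg = PrimRec (Proj 0) (Comp Succ [Proj 1])"
definition "pred_alg = PrimRec Zero (Proj 0)"
definition "monus_alg = Comp (PrimRec (Proj 0) (Comp pred_alg [Proj 1])) [Proj 1, Proj 0]"
definition "triangle_alg = PrimRec Zero (Comp add_alg [Comp Succ [Proj 0], Proj 1])"
definition "pair_alg = Comp add_alg [Comp triangle_alg [add_alg], Proj 0]"
text \<open>
  For \<open>z = prod_encode (m, n) = triangle (m + n) + m\<close> the number \<open>m + n\<close> is the least \<open>k\<close> with
  \<open>z < triangle (k + 1)\<close>.
\<close>
definition "root_alg = Mu (Comp monus_alg [Comp Succ [Proj 1], Comp triangle_alg [Comp Succ [Proj 0]]])"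
definition "fst_alg = Comp monus_alg [Proj 0, Comp triangle_alg [root_alg]]"
definition "snd_alg = Comp monus_alg [root_alg, fst_alg]"

lemma computes_add: "computes add_alg [m, n] (m + n)"
  unfolding add_alg_def
proof (induction m)
  case (Suc m)
  moreover have "computes (Comp Succ [Proj 1]) [m, m + n, n] (Suc m + n)"
    by (rule computes_Comp1[OF computes_Proj]) (auto intro: computes.Succ)
  ultimately show ?case by (rule computes.PrimRec_Suc)
qed (auto intro!: computes.PrimRec_0 computes_Proj)

lemma computes_pred: "computes pred_alg [n] (n - 1)"
  unfolding pred_alg_def
proof (induction n)
  case (Suc n)
  then show ?case by (rule computes.PrimRec_Suc) (auto intro: computes_Proj)
qed (auto intro!: computes.PrimRec_0 computes.Zero)

lemma computes_monus: "computes monus_alg [m, n] (m - n)"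
proof -
  have "computes (PrimRec (Proj 0) (Comp pred_alg [Proj 1])) [n, m] (m - n)"
  proof (induction n)
    case (Suc n)
    moreover have "computes (Comp pred_alg [Proj 1]) [n, m - n, m] (m - Suc n)"
      using computes_pred[of "m - n"] by (intro computes_Comp1 computes_Proj) auto
    ultimately show ?case by (rule computes.PrimRec_Suc)
  qed (auto intro!: computes.PrimRec_0 computes_Proj)
  then show ?thesis
    unfolding monus_alg_def by (rule computes_Comp2[rotated 2]) (auto intro: computes_Proj)
qed

lemma computes_triangle: "computes triangle_alg [n] (triangle n)"
  unfolding triangle_alg_def
proof (induction n)
  case (Suc n)
  moreover have "computes (Comp add_alg [Comp Succ [Proj 0], Proj 1]) [n, triangle n] (triangle (Suc n))"
    using computes_add[of "Suc n" "triangle n"]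
    by (intro computes_Comp2) (auto intro!: computes_Comp1 computes.Succ computes_Proj simp: add.commute)
  ultimately show ?case by (rule computes.PrimRec_Suc)
qed (auto intro!: computes.PrimRec_0 computes.Zero)

lemma computes_pair: "computes pair_alg [m, n] (prod_encode (m, n))"
  unfolding pair_alg_def prod_encode_def prod.case
  by (rule computes_Comp2[OF computes_Comp1[OF computes_add computes_triangle] computes_Proj
        computes_add]) auto

lemma computes_root: "computes root_alg [prod_encode (m, n)] (m + n)"
  unfolding root_alg_def
proof (rule computes.Mu)
  let ?z = "prod_encode (m, n)"
  let ?f = "Comp monus_alg [Comp Succ [Proj 1], Comp triangle_alg [Comp Succ [Proj 0]]]"
  have f: "computes ?f [k, ?z] (Suc ?z - triangle (Suc k))" for k
    by (rule computes_Comp2[OF computes_Comp1[OF computes_Proj computes.Succ]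
          computes_Comp1[OF computes_Comp1[OF computes_Proj computes.Succ] computes_triangle]
          computes_monus]) auto
  have "Suc ?z - triangle (Suc (m + n)) = 0"
    by (simp add: prod_encode_def)
  with f show "computes ?f [m + n, ?z] 0" by metis
  have "triangle (Suc k) \<le> ?z" if "k < m + n" for k
  proof -
    have "triangle (Suc k) \<le> triangle (m + n)"
      by (rule lift_Suc_mono_le) (use that in auto)
    then show ?thesis by (simp add: prod_encode_def)
  qed
  with f show "\<forall>k<m + n. \<exists>y. computes ?f [k, ?z] (Suc y)"
    by (metis Suc_diff_le add_Suc_right)
qed

lemma computes_fst: "computes fst_alg [prod_encode (m, n)] m"
  using computes_monus[of "prod_encode (m, n)" "triangle (m + n)"]
  unfolding fst_alg_def
  by (intro computes_Comp2[OF computes_Proj computes_Comp1[OF computes_root computes_triangle]])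
    (auto simp: prod_encode_def)

lemma computes_snd: "computes snd_alg [prod_encode (m, n)] n"
  using computes_monus[of "m + n" m]
  unfolding snd_alg_def by (intro computes_Comp2[OF computes_root computes_fst]) auto

section \<open>Computable functions on numbered types\<close>

definition computable :: "('a :: numbered \<Rightarrow> 'b :: numbered) \<Rightarrow> bool" where
  "computable f \<longleftrightarrow> (\<exists>alg. \<forall>x. computes alg [encode x] (encode (f x)))"

definition decidable :: "('a :: numbered \<Rightarrow> bool) \<Rightarrow> bool" where
  "decidable P \<longleftrightarrow> computable (\<lambda>x. of_bool (P x) :: nat)"

lemma computable_id: "computable (\<lambda>x. x)"
  unfolding computable_def by (intro exI[of _ "Proj 0"] allI computes_Proj) auto

lemma computable_compose:
  assumes "computable f" "computable g"
  shows "computable (\<lambda>x. f (g x))"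
proof -
  obtain F G where "\<And>x. computes F [encode x] (encode (f x))" "\<And>x. computes G [encode x] (encode (g x))"
    using assms unfolding computable_def by metis
  then show ?thesis
    unfolding computable_def by (meson computes_Comp1)
qed

lemma computable_binary:
  assumes h: "\<And>a b. computes H [encode a, encode b] (encode (h a b))"
    and "computable f" "computable g"
  shows "computable (\<lambda>x. h (f x) (g x))"
proof -
  obtain F G where "\<And>x. computes F [encode x] (encode (f x))" "\<And>x. computes G [encode x] (encode (g x))"
    using assms unfolding computable_def by metis
  then show ?thesis
    unfolding computable_def by (intro exI[of _ "Comp H [F, G]"] allI computes_Comp2[OF _ _ h])
qed

lemma computable_const: "computable (\<lambda>x. c)"
proof -
  have "\<exists>alg. \<forall>xs. computes alg xs n" for n
  proof (induction n)
    case 0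
    show ?case using computes.Zero by blast
  next
    case (Suc n)
    then obtain alg where "computes alg xs n" for xs by blast
    then have "computes (Comp Succ [alg]) xs (Suc n)" for xs
      using computes.Succ by (rule computes_Comp1)
    then show ?case by blast
  qed
  then show ?thesis unfolding computable_def by blast
qed

lemma computable_Pair: "computable f \<Longrightarrow> computable g \<Longrightarrow> computable (\<lambda>x. (f x, g x))"
  by (rule computable_binary[where h = Pair and H = pair_alg])
    (simp_all add: encode_prod_def computes_pair)

lemma computable_fst: "computable f \<Longrightarrow> computable (\<lambda>x. fst (f x))"
  by (rule computable_compose[where f = fst])
    (auto simp: computable_def encode_prod_def intro: computes_fst)

lemma computable_snd: "computable f \<Longrightarrow> computable (\<lambda>x. snd (f x))"
  by (rule computable_compose[where f = snd])
    (auto simp: computable_def encode_prod_def intro: computes_snd)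

text \<open>A program cannot tell a datum from its number.\<close>
lemma computable_encode: "computable f \<Longrightarrow> computable (\<lambda>x. encode (f x))"
  by (simp add: computable_def encode_nat_def)

lemma computable_add: "computable f \<Longrightarrow> computable g \<Longrightarrow> computable (\<lambda>x. f x + g x :: nat)"
  by (rule computable_binary[where h = "(+)" and H = add_alg])
    (simp_all only: encode_nat_def computes_add)

lemma computable_monus: "computable f \<Longrightarrow> computable g \<Longrightarrow> computable (\<lambda>x. f x - g x :: nat)"
  by (rule computable_binary[where h = "(-)" and H = monus_alg])
    (simp_all only: encode_nat_def computes_monus)

text \<open>
  The step of a primitive recursion receives its arguments separately, while a computable function
  of several arguments expects them packed into one number; hence the pairing in front of the step.
\<close>
lemma computable_rec_nat:
  assumes n: "computable n" and b: "computable b"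
    and g: "computable (\<lambda>z. g (fst z) (fst (snd z)) (snd (snd z)))"
  shows "computable (\<lambda>x. rec_nat (b x) (\<lambda>k y. g k y x) (n x))"
proof -
  obtain B where B: "\<And>x. computes B [encode x] (encode (b x))"
    using b unfolding computable_def by metis
  obtain G where G: "\<And>k y x. computes G [encode (k, y, x)] (encode (g k y x))"
    using g unfolding computable_def by (metis fst_conv snd_conv)
  let ?G = "Comp G [Comp pair_alg [Proj 0, Comp pair_alg [Proj 1, Proj 2]]]"
  have step: "computes ?G [k, encode y, encode x] (encode (g k y x))" for k y x
  proof (rule computes_Comp1[OF _ G])
    show "computes (Comp pair_alg [Proj 0, Comp pair_alg [Proj 1, Proj 2]])
        [k, encode y, encode x] (encode (k, y, x))"
      unfolding encode_prod_def encode_nat_def fst_conv snd_conv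
      by (rule computes_Comp2[OF computes_Proj
            computes_Comp2[OF computes_Proj computes_Proj computes_pair] computes_pair]) auto
  qed
  have "computes (PrimRec B ?G) [m, encode x] (encode (rec_nat (b x) (\<lambda>k y. g k y x) m))" for m x
  proof (induction m)
    case 0
    show ?case by (simp add: computes.PrimRec_0 B)
  next
    case (Suc m)
    from computes.PrimRec_Suc[OF this step] show ?case by simp
  qed
  then have "computes (PrimRec B ?G) [encode m, encode x]
      (encode (rec_nat (b x) (\<lambda>k y. g k y x) m))" for m x
    by (simp add: encode_nat_def)
  from computable_binary[OF this n computable_id] show ?thesis .
qed

text \<open>
  The code of a nonempty list is the successor of the code of the pair of its head and tail, so one
  unfolding of a primitive recursion that ignores the previous value performs the case distinction.
  The previous values still have to exist for the recursion to halt (fact \<open>total\<close>).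
\<close>
lemma computable_case_list:
  fixes l :: "'a :: numbered \<Rightarrow> 'b :: numbered list"
  assumes l: "computable l" and b: "computable b"
    and g: "computable (\<lambda>z. g (fst (fst z)) (snd (fst z)) (snd z))"
  shows "computable (\<lambda>x. case l x of [] \<Rightarrow> b x | y # ys \<Rightarrow> g y ys x)"
proof -
  obtain B where B: "\<And>x. computes B [encode x] (encode (b x))"
    using b unfolding computable_def by metis
  obtain G where G: "\<And>y ys x. computes G [encode ((y, ys), x)] (encode (g y ys x))"
    using g unfolding computable_def by (metis fst_conv snd_conv)
  let ?G = "Comp G [Comp pair_alg [Proj 0, Proj 2]]"
  have step: "computes ?G [encode (y, ys), v, encode x] (encode (g y ys x))" for v y ys x
  proof (rule computes_Comp1[OF _ G])
    show "computes (Comp pair_alg [Proj 0, Proj 2]) [encode (y, ys), v, encode x] (encode ((y, ys), x))"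
      unfolding encode_prod_def[of "((y, ys), x)"] fst_conv snd_conv
      by (rule computes_Comp2[OF computes_Proj computes_Proj computes_pair]) auto
  qed
  have total: "\<exists>v. computes (PrimRec B ?G) [m, encode x] v" for m and x :: 'a
  proof (induction m)
    case 0
    show ?case using computes.PrimRec_0[OF B] by blast
  next
    case (Suc m)
    then obtain v where v: "computes (PrimRec B ?G) [m, encode x] v" by blast
    obtain y :: 'b and ys :: "'b list" where "decode m = (y, ys)" by fastforce
    then have "m = encode (y, ys)" by (metis encode_decode)
    have "computes ?G [m, v, encode x] (encode (g y ys x))"
      unfolding \<open>m = encode (y, ys)\<close> by (rule step)
    with v show ?case by (metis computes.PrimRec_Suc)
  qed
  have "computes (PrimRec B ?G) [encode ys, encode x]
      (encode (case ys of [] \<Rightarrow> b x | y # ys \<Rightarrow> g y ys x))" for ys x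
  proof (cases ys)
    case Nil
    with B show ?thesis by (auto simp: encode_Nil intro: computes.PrimRec_0)
  next
    case (Cons y ys')
    obtain v where "computes (PrimRec B ?G) [encode (y, ys'), encode x] v"
      using total by blast
    then show ?thesis
      unfolding Cons encode_Cons list.case by (rule computes.PrimRec_Suc) (rule step)
  qed
  from computable_binary[OF this l computable_id] show ?thesis .
qed

lemma computable_if:
  assumes "decidable P" "computable f" "computable g"
  shows "computable (\<lambda>x. if P x then f x else g x)"
proof -
  have "computable (\<lambda>x. rec_nat (g x) (\<lambda>k y. f x) (of_bool (P x)))"
    using assms(1,3) unfolding decidable_def
    by (rule computable_rec_nat)
      (intro computable_compose[OF assms(2)] computable_snd computable_id)
  moreover have "(\<lambda>x. rec_nat (g x) (\<lambda>k y. f x) (of_bool (P x))) = (\<lambda>x. if P x then f x else g x)"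
    by auto
  ultimately show ?thesis by simp
qed

lemma computable_Cons:
  assumes "computable f" "computable g"
  shows "computable (\<lambda>x. f x # g x)"
  using computable_add[OF computable_const[of 1] computable_encode[OF computable_Pair[OF assms]]]
  unfolding computable_def by (simp add: encode_Cons encode_nat_def)

text \<open>
  The loop state consists of the accumulator and the rest of the list. The code of the list is used as
  the number of rounds; rounds after the end of the list change nothing.
\<close>
lemma computable_foldl:
  assumes f: "computable (\<lambda>z. f (fst z) (fst (snd z)) (snd (snd z)))"
    and s: "computable s" and l: "computable l"
  shows "computable (\<lambda>x. foldl (\<lambda>a y. f a y x) (s x) (l x))"
proof -
  define step where "step x t = (case snd t of [] \<Rightarrow> t | y # ys \<Rightarrow> (f (fst t) y x, ys))" for x t
  have iterate: "rec_nat (a, ys) (\<lambda>k. step x) n = (foldl (\<lambda>a y. f a y x) a (take n ys), drop n ys)" for x a ys n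
  proof (induction n)
    case (Suc n)
    show ?case
    proof (cases "drop n ys")
      case Nil
      with Suc show ?thesis by (simp add: step_def)
    next
      case (Cons z zs)
      then have "take (Suc n) ys = take n ys @ [z]" "drop (Suc n) ys = zs"
        by (metis list.distinct(1) drop_eq_Nil hd_drop_conv_nth linorder_not_le list.sel(1)
            take_Suc_conv_app_nth) (metis Cons drop_Suc list.sel(3) tl_drop)
      with Suc Cons show ?thesis by (simp add: step_def)
    qed
  qed simp
  have "computable (\<lambda>z. (fst (fst (snd (snd z))), fst (fst z), snd (snd (snd z))))"
    by (intro computable_Pair computable_fst computable_snd computable_id)
  from computable_compose[OF f this]
  have "computable (\<lambda>z. step (snd (snd z)) (fst (snd z)))"
    unfolding step_def fst_conv snd_conv
    by (intro computable_case_list computable_Pair computable_fst computable_snd computable_id)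
  then have "computable (\<lambda>x. fst (rec_nat (s x, l x) (\<lambda>k t. step x t) (encode (l x))))"
    using s l by (intro computable_fst computable_rec_nat computable_Pair computable_encode)
  then show ?thesis
    by (simp add: iterate length_le_encode)
qed

section \<open>Decidable predicates\<close>

named_theorems computable_intros

lemma decidable_const: "decidable (\<lambda>x. c)"
  unfolding decidable_def by (rule computable_const)

lemma decidable_if:
  assumes "decidable P" "decidable Q" "decidable S"
  shows "decidable (\<lambda>x. if P x then Q x else S x)"
proof -
  have "computable (\<lambda>x. if P x then of_bool (Q x) else of_bool (S x) :: nat)"
    using assms by (intro computable_if) (simp_all add: decidable_def)
  moreover have "(if P x then of_bool (Q x) else of_bool (S x) :: nat) = of_bool (if P x then Q x else S x)" for x
    by simp
  ultimately show ?thesis by (simp only: decidable_def)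
qed

lemma decidable_not: "decidable P \<Longrightarrow> decidable (\<lambda>x. \<not> P x)"
  and decidable_conj: "decidable P \<Longrightarrow> decidable Q \<Longrightarrow> decidable (\<lambda>x. P x \<and> Q x)"
  and decidable_disj: "decidable P \<Longrightarrow> decidable Q \<Longrightarrow> decidable (\<lambda>x. P x \<or> Q x)"
  and decidable_imp: "decidable P \<Longrightarrow> decidable Q \<Longrightarrow> decidable (\<lambda>x. P x \<longrightarrow> Q x)"
proof -
  have eq: "(\<not> p) = (if p then False else True)" "(p \<and> q) = (if p then q else False)"
    "(p \<or> q) = (if p then True else q)" "(p \<longrightarrow> q) = (if p then q else True)" for p q
    by simp_all
  show "decidable P \<Longrightarrow> decidable (\<lambda>x. \<not> P x)"
    "decidable P \<Longrightarrow> decidable Q \<Longrightarrow> decidable (\<lambda>x. P x \<and> Q x)"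
    "decidable P \<Longrightarrow> decidable Q \<Longrightarrow> decidable (\<lambda>x. P x \<or> Q x)"
    "decidable P \<Longrightarrow> decidable Q \<Longrightarrow> decidable (\<lambda>x. P x \<longrightarrow> Q x)"
    unfolding eq by (intro decidable_if decidable_const; assumption)+
qed

lemma decidable_eq:
  assumes "computable f" "computable g"
  shows "decidable (\<lambda>x. f x = g x)"
proof -
  have "computable (\<lambda>x. 1 - ((encode (f x) - encode (g x)) + (encode (g x) - encode (f x))) :: nat)"
    using assms by (intro computable_monus computable_add computable_const computable_encode)
  moreover have "1 - ((encode (f x) - encode (g x)) + (encode (g x) - encode (f x))) = of_bool (f x = g x)" for x
  proof (cases "f x = g x")
    case False
    then have "encode (f x) \<noteq> encode (g x)" by simp
    then have "1 \<le> (encode (f x) - encode (g x)) + (encode (g x) - encode (f x))" by linarith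
    with False show ?thesis by simp
  qed simp
  ultimately show ?thesis
    by (simp add: decidable_def)
qed

lemma decidable_Ball_set:
  assumes "decidable (\<lambda>z. P (fst z) (snd z))" and l: "computable l"
  shows "decidable (\<lambda>x. \<forall>y\<in>set (l x). P y x)"
proof -
  have "decidable (\<lambda>z. P (fst (snd z)) (snd (snd z)))"
    using computable_compose[OF assms(1)[unfolded decidable_def] computable_snd[OF computable_id]]
    by (simp add: decidable_def)
  then have "computable (\<lambda>z. if P (fst (snd z)) (snd (snd z)) then fst z else (0 :: nat))"
    by (intro computable_if computable_fst computable_id computable_const)
  from computable_foldl[OF this computable_const[of 1] l]
  have "computable (\<lambda>x. foldl (\<lambda>a y. if P y x then a else 0) (1 :: nat) (l x))" .
  moreover have "foldl (\<lambda>a y. if P y x then a else 0) (of_bool b) ys = (of_bool (b \<and> (\<forall>y\<in>set ys. P y x)) :: nat)"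
    for x ys b
  proof (induction ys arbitrary: b)
    case (Cons y ys)
    from Cons[of "b \<and> P y x"] show ?case
      by (cases "P y x") auto
  qed simp
  from this[of _ True]
  have "foldl (\<lambda>a y. if P y x then a else 0) (1 :: nat) (l x) = of_bool (\<forall>y\<in>set (l x). P y x)" for x
    by simp
  ultimately show ?thesis
    by (simp add: decidable_def)
qed

lemma decidable_mem_set:
  assumes "computable f" "computable l"
  shows "decidable (\<lambda>x. f x \<in> set (l x))"
proof -
  have "decidable (\<lambda>x. \<not> (\<forall>y\<in>set (l x). y \<noteq> f x))"
    by (intro decidable_not decidable_Ball_set decidable_eq computable_fst computable_id assms
        computable_compose[OF assms(1)] computable_snd)
  moreover have "(\<not> (\<forall>y\<in>set (l x). y \<noteq> f x)) = (f x \<in> set (l x))" for x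
    by blast
  ultimately show ?thesis by (simp only:)
qed

lemma computable_append:
  assumes "computable f" "computable g"
  shows "computable (\<lambda>x. f x @ g x)"
proof -
  have "computable (\<lambda>x. foldl (\<lambda>zs y. y # zs) (g x) (foldl (\<lambda>zs y. y # zs) [] (f x)))"
    by (intro computable_foldl computable_Cons computable_fst computable_snd computable_id
        computable_const assms)
  moreover have "foldl (\<lambda>zs y. y # zs) ys xs = rev xs @ ys" for xs ys :: "'b list"
    by (induction xs arbitrary: ys) auto
  ultimately show ?thesis by simp
qed

lemmas [computable_intros] =
  computable_id computable_Pair computable_fst computable_snd computable_const computable_if
  computable_foldl computable_Cons computable_append
  decidable_const decidable_not decidable_conj decidable_disj decidable_imp
  decidable_eq decidable_Ball_set decidable_mem_set

text \<open>
  Post's theorem, relative to the set of the inputs with a witness of exactly one kind. The search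
  runs over pairs of candidates, of which only one has to be a witness: the other component can be
  anything.
\<close>
lemma semidecidable_alternatives_algorithm:
  fixes P :: "'c :: numbered \<Rightarrow> 'a :: numbered \<Rightarrow> bool" and Q :: "'d :: numbered \<Rightarrow> 'a \<Rightarrow> bool"
  assumes "decidable (\<lambda>z. P (fst z) (snd z))" and "decidable (\<lambda>z. Q (fst z) (snd z))"
  obtains alg where
    "\<And>x. (\<exists>c. P c x) \<noteq> (\<exists>d. Q d x) \<Longrightarrow> computes alg [encode x] (of_bool (\<exists>c. P c x))"
proof -
  define T where "T z \<longleftrightarrow> P (fst (fst z)) (snd z) \<or> Q (snd (fst z)) (snd z)" for z
  have P: "decidable (\<lambda>z :: ('c \<times> 'd) \<times> 'a. P (fst (fst z)) (snd z))"
    using computable_compose[OF assms(1)[unfolded decidable_def],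
        of "\<lambda>z :: ('c \<times> 'd) \<times> 'a. (fst (fst z), snd z)"]
    by (simp add: decidable_def computable_intros)
  have Q: "decidable (\<lambda>z :: ('c \<times> 'd) \<times> 'a. Q (snd (fst z)) (snd z))"
    using computable_compose[OF assms(2)[unfolded decidable_def],
        of "\<lambda>z :: ('c \<times> 'd) \<times> 'a. (snd (fst z), snd z)"]
    by (simp add: decidable_def computable_intros)
  have "decidable (\<lambda>z. \<not> T z)"
    unfolding T_def by (intro decidable_not decidable_disj P Q)
  then obtain F where F: "computes F [encode z] (of_bool (\<not> T z))" for z
    unfolding decidable_def computable_def encode_nat_def by blast
  obtain A where A: "computes A [encode z] (of_bool (P (fst (fst z)) (snd z)))" for z :: "('c \<times> 'd) \<times> 'a"
    using P unfolding decidable_def computable_def encode_nat_def by blast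
  have F': "computes (Comp F [pair_alg]) [n, encode x] (of_bool (\<not> T (decode n, x)))" for n x
    using computes_Comp1[OF computes_pair F[of "(decode n, x)", unfolded encode_prod_def[of "(decode n, x)"]]] by simp
  show thesis
  proof (rule that[of "Comp A [Comp pair_alg [Mu (Comp F [pair_alg]), Proj 0]]"])
    fix x assume one: "(\<exists>c. P c x) \<noteq> (\<exists>d. Q d x)"
    then have "\<exists>n. T (decode n, x)"
      unfolding T_def by (metis decode_encode fst_conv snd_conv)
    define n where "n = (LEAST n. T (decode n, x))"
    have T: "T (decode n, x)" and min: "\<forall>m<n. \<not> T (decode m, x)"
      unfolding n_def using \<open>\<exists>n. T (decode n, x)\<close> by (auto intro: LeastI dest: not_less_Least)
    have Mu: "computes (Mu (Comp F [pair_alg])) [encode x] n"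
    proof (rule computes.Mu)
      show "computes (Comp F [pair_alg]) [n, encode x] 0"
        using F'[of n x] T by simp
      show "\<forall>m<n. \<exists>k. computes (Comp F [pair_alg]) [m, encode x] (Suc k)"
        using F' min by (metis of_bool_eq(2) One_nat_def)
    qed
    have "P (fst (decode n :: 'c \<times> 'd)) x \<longleftrightarrow> (\<exists>c. P c x)"
      using T one unfolding T_def by auto
    then have A': "computes A [prod_encode (n, encode x)] (of_bool (\<exists>c. P c x))"
      using A[of "(decode n, x)"] by (simp add: encode_prod_def[of "(decode n, x)"])
    show "computes (Comp A [Comp pair_alg [Mu (Comp F [pair_alg]), Proj 0]]) [encode x] (of_bool (\<exists>c. P c x))"
      by (rule computes_Comp1[OF computes_Comp2[OF Mu computes_Proj computes_pair] A']) auto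
  qed
qed

section \<open>Checking certificates\<close>

definition lookup :: "'b \<Rightarrow> ('a \<times> 'b) list \<Rightarrow> 'a \<Rightarrow> 'b" where
  "lookup d t k = foldl (\<lambda>y e. if fst e = k then snd e else y) d t"

lemma computable_lookup [computable_intros]:
  assumes "computable d" "computable t" "computable k"
  shows "computable (\<lambda>x. lookup (d x) (t x) (k x))"
proof -
  have "computable (\<lambda>z. k (snd (snd z)))"
    by (intro computable_compose[OF assms(3)] computable_snd computable_id)
  then show ?thesis
    unfolding lookup_def by (intro computable_intros assms)
qed

lemma lookup_eq:
  assumes "\<And>y'. (k, y') \<in> set t \<Longrightarrow> y' = y" and "(k, y) \<in> set t"
  shows "lookup d t k = y"
proof -
  have keep: "foldl (\<lambda>y e. if fst e = k then snd e else y) y t = y"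
    if "\<And>y'. (k, y') \<in> set t \<Longrightarrow> y' = y" for t
    using that
  proof (induction t)
    case (Cons e t)
    then have "fst e = k \<longrightarrow> snd e = y" by (cases e) auto
    with Cons show ?case by simp
  qed simp
  obtain t1 t2 where t: "t = t1 @ (k, y) # t2"
    using assms(2) by (metis split_list)
  have "foldl (\<lambda>y e. if fst e = k then snd e else y) y t2 = y"
    by (rule keep) (use assms(1) t in auto)
  then show ?thesis by (simp add: lookup_def t)
qed

text \<open>
  From here on, vertices and edges are numbers. The list \<open>E\<close> consists of the edges with their sources
  and targets, the list \<open>L\<close> of the relations (in both directions) with their start vertices.
\<close>

definition target :: "(nat \<times> nat \<times> nat) list \<Rightarrow> nat \<Rightarrow> nat list \<Rightarrow> nat" where
  "target E u p = foldl (\<lambda>_ e. snd (lookup (0, 0) E e)) u p"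

text \<open>
  An inapplicable replacement is ignored, so that every list of replacements leads to a path equal to
  the original one. The position of a replacement has to lie over the start vertex of the relation,
  which is not automatic: if \<open>l\<close> is empty, then \<open>p = a @ l @ b\<close> holds at every position.
\<close>
definition rewrite ::
  "(nat \<times> nat \<times> nat) list \<Rightarrow> (nat \<times> nat list \<times> nat list) list \<Rightarrow> nat
    \<Rightarrow> nat list \<Rightarrow> nat list \<times> (nat \<times> nat list \<times> nat list) \<times> nat list \<Rightarrow> nat list" where
  "rewrite E L u p = (\<lambda>(a, (v, l, r), b).
     if p = a @ l @ b \<and> (v, l, r) \<in> set L \<and> target E u a = v then a @ r @ b else p)"

text \<open>A missing entry leaves the state in place, so that every table defines an action.\<close>
definition act :: "(('s \<times> 'e) \<times> 's) list \<Rightarrow> 's \<Rightarrow> 'e list \<Rightarrow> 's" where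
  "act t s p = foldl (\<lambda>s e. lookup s t (s, e)) s p"

text \<open>
  A state is a pair of a vertex, over which it lies, and a number. A model amounts to a functor from
  the presented category to finite sets: the edges act on the states over their sources, and the two
  sides of a relation act alike.
\<close>
definition model ::
  "(nat \<times> nat \<times> nat) list \<Rightarrow> (nat \<times> nat list \<times> nat list) list
    \<Rightarrow> (nat \<times> nat) list \<Rightarrow> (((nat \<times> nat) \<times> nat) \<times> nat \<times> nat) list \<Rightarrow> bool" where
  "model E L S t \<longleftrightarrow> (\<forall>s\<in>set S.
     (\<forall>(e, a, b)\<in>set E. a = fst s \<longrightarrow> act t s [e] \<in> set S \<and> fst (act t s [e]) = b) \<and>
     (\<forall>(v, l, r)\<in>set L. v = fst s \<longrightarrow> act t s l = act t s r))"

definition proves_equal where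
  "proves_equal E L c = (\<lambda>((u, p), (u', q)). u = u' \<and> foldl (rewrite E L u) p c = q)"

definition proves_unequal where
  "proves_unequal E L = (\<lambda>(S, t, s) ((u, p), (u', q)). u \<noteq> u' \<or>
     model E L S t \<and> s \<in> set S \<and> fst s = u \<and> act t s p \<noteq> act t s q)"

lemma computable_act [computable_intros]:
  assumes "computable t" "computable s" "computable p"
  shows "computable (\<lambda>x. act (t x) (s x) (p x))"
proof -
  have "computable (\<lambda>z. t (snd (snd z)))"
    by (intro computable_compose[OF assms(1)] computable_snd computable_id)
  then show ?thesis
    unfolding act_def by (intro computable_intros assms)
qed

lemma computable_rewrite [computable_intros]:
  assumes "computable u" "computable p" "computable s"
  shows "computable (\<lambda>x. rewrite E L (u x) (p x) (s x))"
  unfolding rewrite_def target_def case_prod_beta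
  by (intro computable_intros assms)

lemma decidable_proves_equal: "decidable (\<lambda>z. proves_equal E L (fst z) (snd z))"
  unfolding proves_equal_def case_prod_beta
  by (intro computable_intros)

lemma decidable_proves_unequal: "decidable (\<lambda>z. proves_unequal E L (fst z) (snd z))"
  unfolding proves_unequal_def model_def case_prod_beta
  by (intro computable_intros)

section \<open>Certificates of equality\<close>

locale coded_presentation = fin_digraph X for X :: "('v, 'e) pre_digraph" +
  fixes R :: "(('v, 'e) path \<times> ('v, 'e) path) set"
    and \<nu> :: "'v \<Rightarrow> nat" and \<eta> :: "'e \<Rightarrow> nat"
    and E :: "(nat \<times> nat \<times> nat) list" and L :: "(nat \<times> nat list \<times> nat list) list"
  assumes presentation: "finite_presentation X R"
    and inj_\<nu>: "inj_on \<nu> (verts X)" and inj_\<eta>: "inj_on \<eta> (arcs X)"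
    and set_E: "set E = (\<lambda>e. (\<eta> e, \<nu> (tail X e), \<nu> (head X e))) ` arcs X"
    and set_L: "set L = (\<lambda>((u, l, v), (u', r, v')). (\<nu> u, map \<eta> l, map \<eta> r)) ` (R \<union> R\<inverse>)"
begin

abbreviation cong :: "'v \<Rightarrow> 'v \<Rightarrow> ('e list \<times> 'e list) set" where
  "cong \<equiv> generated_congruence (free_category X) R"

lemma free_category_simps [simp]:
  "Obj (free_category X) = verts X" "Mor (free_category X) u v = {p. awalk u p v}"
  "Idt (free_category X) u = []" "Cmp (free_category X) u v w p q = p @ q"
  by (simp_all add: free_category_def)

lemma category_free: "category (free_category X)"
  by (rule free_category_category) (rule wf_digraph_axioms)

lemma relation_parallel:
  assumes "((u, l, v), (u', r, v')) \<in> R \<union> R\<inverse>"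
  shows "u' = u" "v' = v" "awalk u l v" "awalk u r v" "u \<in> verts X" "v \<in> verts X"
  using presentation assms by (auto simp: finite_presentation_def parallel_def arrows_def)

lemma set_L_E:
  assumes "(w, l', r') \<in> set L"
  obtains u l r v where "w = \<nu> u" "l' = map \<eta> l" "r' = map \<eta> r" "((u, l, v), (u, r, v)) \<in> R \<union> R\<inverse>"
proof -
  obtain z where z: "z \<in> R \<union> R\<inverse>"
      "(w, l', r') = (\<lambda>((u, l, v), (u', r, v')). (\<nu> u, map \<eta> l, map \<eta> r)) z"
    using assms unfolding set_L by (rule imageE)
  obtain u l v u' r v' where z_eq: "z = ((u, l, v), (u', r, v'))"
    by (metis prod_cases3 surj_pair)
  show thesis
    using that[of u l r v] z relation_parallel(1,2)[of u l v u' r v'] by (simp add: z_eq)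
qed

lemma set_L_I:
  "((u, l, v), (u, r, v)) \<in> R \<union> R\<inverse> \<Longrightarrow> (\<nu> u, map \<eta> l, map \<eta> r) \<in> set L"
  unfolding set_L by (rule image_eqI[where x = "((u, l, v), (u, r, v))"]) auto

lemma congruence_cong: "congruence (free_category X) cong"
  using presentation category_free
  by (intro generated_congruence_congruence) (auto simp: finite_presentation_def)

lemma equiv_cong:
  "u \<in> verts X \<Longrightarrow> v \<in> verts X \<Longrightarrow> equiv {p. awalk u p v} (cong u v)"
  using congruence_cong unfolding congruence_def free_category_simps by blast

lemma cong_refl: "awalk u p v \<Longrightarrow> (p, p) \<in> cong u v"
  using equiv_cong[of u v] by (auto simp: equiv_def refl_on_def)

lemma cong_append:
  "u \<in> verts X \<Longrightarrow> v \<in> verts X \<Longrightarrow> w \<in> verts X \<Longrightarrow> (p, p') \<in> cong u v \<Longrightarrow> (q, q') \<in> cong v w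
    \<Longrightarrow> (p @ q, p' @ q') \<in> cong u w"
  using congruence_cong unfolding congruence_def free_category_simps by blast

lemma cong_trans:
  "u \<in> verts X \<Longrightarrow> v \<in> verts X \<Longrightarrow> (p, q) \<in> cong u v \<Longrightarrow> (q, r) \<in> cong u v \<Longrightarrow> (p, r) \<in> cong u v"
  using equiv_cong[of u v] by (auto simp: equiv_def elim: transE)

lemma cong_awalk:
  "u \<in> verts X \<Longrightarrow> v \<in> verts X \<Longrightarrow> (p, q) \<in> cong u v \<Longrightarrow> awalk u q v"
  using equiv_cong[of u v] by (auto simp: equiv_def)

lemma cong_relation:
  assumes "((u, l, v), (u, r, v)) \<in> R \<union> R\<inverse>"
  shows "(l, r) \<in> cong u v"
proof -
  have sym: "sym (cong u v)"
    using equiv_cong[of u v] relation_parallel(5,6)[OF assms] by (simp add: equiv_def)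
  have "((u, l, v), (u, r, v)) \<in> R \<Longrightarrow> (l, r) \<in> cong u v" for l r
    unfolding generated_congruence_def by blast
  with assms sym show ?thesis by (auto dest: symD)
qed

text \<open>Minimality of the generated congruence, as an induction principle.\<close>
lemma cong_induct:
  assumes "(p, q) \<in> cong u v" and "u \<in> verts X" and "v \<in> verts X"
    and "congruence (free_category X) r"
    and "\<And>u l v r'. ((u, l, v), (u, r', v)) \<in> R \<Longrightarrow> (l, r') \<in> r u v"
  shows "(p, q) \<in> r u v"
proof -
  have "\<forall>A a B A' b B'. ((A, a, B), (A', b, B')) \<in> R \<longrightarrow> (a, b) \<in> r A B"
    using assms(5) relation_parallel(1,2) by blast
  with assms(1,4) show ?thesis
    unfolding generated_congruence_def by blast
qed

lemma target_code: "awalk u p v \<Longrightarrow> target E (\<nu> u) (map \<eta> p) = \<nu> v"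
proof (induction p arbitrary: u)
  case (Cons e p)
  then have e: "e \<in> arcs X" by (simp add: awalk_Cons_iff)
  have "lookup (0, 0) E (\<eta> e) = (\<nu> (tail X e), \<nu> (head X e))"
    by (rule lookup_eq) (use e inj_\<eta> in \<open>auto simp: set_E dest: inj_onD\<close>)
  with Cons show ?case by (simp add: target_def awalk_Cons_iff)
qed (simp add: target_def awalk_Nil_iff)

lemma map_\<eta>_inject: "set p \<subseteq> arcs X \<Longrightarrow> set q \<subseteq> arcs X \<Longrightarrow> map \<eta> p = map \<eta> q \<longleftrightarrow> p = q"
  using inj_\<eta> by (intro inj_on_map_eq_map) (meson Un_least inj_on_subset)

lemma awalk_arcs: "awalk u p v \<Longrightarrow> set p \<subseteq> arcs X"
  by (simp add: awalk_def)

lemma awalk_split: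
  assumes "awalk u (p @ q) v"
  obtains w where "awalk u p w" "awalk w q v"
  using assms by (auto simp: awalk_append_iff)

lemma awalk_unique: "awalk u p v \<Longrightarrow> awalk u p w \<Longrightarrow> v = w"
  by auto

text \<open>
  A replacement that the checker accepts is a replacement in the original path: the code of a path
  determines its edges, and the check of the position ensures that the context and the relation fit
  together.
\<close>
lemma rewrite_cong:
  assumes p: "awalk u p v"
  shows "\<exists>q. rewrite E L (\<nu> u) (map \<eta> p) s = map \<eta> q \<and> (p, q) \<in> cong u v"
proof -
  obtain a w l r b where s: "s = (a, (w, l, r), b)" by (metis prod_cases3)
  show ?thesis
  proof (cases "map \<eta> p = a @ l @ b \<and> (w, l, r) \<in> set L \<and> target E (\<nu> u) a = w")
    case True
    then obtain a0 l1 b0 where split: "p = a0 @ l1 @ b0" "a = map \<eta> a0" "l = map \<eta> l1" "b = map \<eta> b0"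
      by (metis map_eq_append_conv)
    from True obtain x l0 r0 y where rel: "w = \<nu> x" "l = map \<eta> l0" "r = map \<eta> r0"
        "((x, l0, y), (x, r0, y)) \<in> R \<union> R\<inverse>"
      by (blast elim: set_L_E)
    note rel_walks = relation_parallel(3-6)[OF rel(4)]
    obtain x1 y1 where walks: "awalk u a0 x1" "awalk x1 l1 y1" "awalk y1 b0 v"
      using p split(1) by (metis awalk_split)
    have verts: "u \<in> verts X" "v \<in> verts X"
      using p by (auto intro: awalk_hd_in_verts awalk_last_in_verts)
    have "\<nu> x1 = \<nu> x"
      using True target_code[OF walks(1)] rel(1) split(2) by simp
    then have x1: "x1 = x"
      using inj_\<nu> walks(1) rel_walks(3) by (auto dest: inj_onD awalk_last_in_verts)
    have l1: "l1 = l0"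
      using split(3) rel(2) map_\<eta>_inject awalk_arcs walks(2) rel_walks(1) by metis
    have y1: "y1 = y"
      using walks(2) rel_walks(1) awalk_unique unfolding x1 l1 by blast
    have "(a0 @ l0 @ b0, a0 @ r0 @ b0) \<in> cong u v"
      using walks[unfolded x1 l1 y1] rel_walks verts cong_relation[OF rel(4)]
      by (intro cong_append[of u x v] cong_append[of x y v] cong_refl)
    then have "(p, a0 @ r0 @ b0) \<in> cong u v"
      by (simp add: split(1) l1)
    moreover have "rewrite E L (\<nu> u) (map \<eta> p) s = map \<eta> (a0 @ r0 @ b0)"
      using True by (simp add: rewrite_def s split(2,4) rel(3))
    ultimately show ?thesis by blast
  next
    case False
    then have "rewrite E L (\<nu> u) (map \<eta> p) s = map \<eta> p"
      by (auto simp: rewrite_def s)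
    with cong_refl[OF p] show ?thesis by blast
  qed
qed

lemma rewrites_cong:
  assumes "awalk u p v"
  shows "\<exists>q. foldl (rewrite E L (\<nu> u)) (map \<eta> p) c = map \<eta> q \<and> (p, q) \<in> cong u v"
  using assms
proof (induction c arbitrary: p)
  case Nil
  then show ?case using cong_refl by auto
next
  case (Cons s c)
  have verts: "u \<in> verts X" "v \<in> verts X"
    using Cons.prems by (auto intro: awalk_hd_in_verts awalk_last_in_verts)
  obtain p' where p': "rewrite E L (\<nu> u) (map \<eta> p) s = map \<eta> p'" "(p, p') \<in> cong u v"
    using rewrite_cong[OF Cons.prems] by blast
  from Cons.IH[OF cong_awalk[OF verts p'(2)]] p' cong_trans[OF verts p'(2)]
  show ?case by auto
qed

definition step :: "'v \<Rightarrow> 'e list \<Rightarrow> 'e list \<Rightarrow> bool" where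
  "step u p q \<longleftrightarrow> (\<exists>a l r b x y. p = a @ l @ b \<and> q = a @ r @ b \<and> awalk u a x \<and>
     ((x, l, y), (x, r, y)) \<in> R \<union> R\<inverse>)"

text \<open>
  Reachability by replacements is a congruence that contains the relations, hence contains the
  smallest one. It is symmetric because relations are used in both directions.
\<close>
lemma cong_imp_steps:
  assumes "(p, q) \<in> cong u v" and "u \<in> verts X" and "v \<in> verts X"
  shows "(step u)\<^sup>*\<^sup>* p q"
proof -
  define r where "r u v = {(p, q). awalk u p v \<and> awalk u q v \<and> (step u)\<^sup>*\<^sup>* p q}" for u v
  have "symp (step u)" for u
    unfolding step_def by (auto intro!: sympI) blast+
  then have sym: "(step u)\<^sup>*\<^sup>* q p" if "(step u)\<^sup>*\<^sup>* p q" for u p q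
    using that by (metis sympD symp_rtranclp)
  have left: "(step u)\<^sup>*\<^sup>* (a @ p) (a @ q)" if "awalk u a w" "(step w)\<^sup>*\<^sup>* p q" for u a w p q
    using that(2)
  proof induction
    case (step p' q')
    obtain c l r b x y where "p' = c @ l @ b" "q' = c @ r @ b" "awalk w c x"
        "((x, l, y), (x, r, y)) \<in> R \<union> R\<inverse>"
      using step(2) unfolding step_def by blast
    then have "step u (a @ p') (a @ q')"
      unfolding step_def
      by (intro exI[of _ "a @ c"] exI[of _ l] exI[of _ r] exI[of _ b] exI[of _ x] exI[of _ y])
        (use that(1) in \<open>auto intro: awalk_appendI\<close>)
    with step(3) show ?case by (rule rtranclp.rtrancl_into_rtrancl)
  qed simp
  have right: "(step u)\<^sup>*\<^sup>* (p @ b) (q @ b)" if "(step u)\<^sup>*\<^sup>* p q" for u p q b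
    using that
  proof induction
    case (step p' q')
    obtain c l r d x y where "p' = c @ l @ d" "q' = c @ r @ d" "awalk u c x"
        "((x, l, y), (x, r, y)) \<in> R \<union> R\<inverse>"
      using step(2) unfolding step_def by blast
    then have "step u (p' @ b) (q' @ b)"
      unfolding step_def
      by (intro exI[of _ c] exI[of _ l] exI[of _ r] exI[of _ "d @ b"] exI[of _ x] exI[of _ y]) auto
    with step(3) show ?case by (rule rtranclp.rtrancl_into_rtrancl)
  qed simp
  have "equiv {p. awalk u p v} (r u v)" for u v
    by (rule equivI) (auto simp: r_def refl_on_def intro: sym intro!: symI transI)
  moreover have "(p @ q, p' @ q') \<in> r u w" if "(p, p') \<in> r u v" "(q, q') \<in> r v w" for u v w p p' q q'
    using that left[of u p' v q q'] right[of u p p' q] unfolding r_def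
    by (auto intro: awalk_appendI)
  ultimately have "congruence (free_category X) r"
    unfolding congruence_def by simp
  moreover have "(l, r') \<in> r u v" if "((u, l, v), (u, r', v)) \<in> R" for u l v r'
  proof -
    have rel: "((u, l, v), (u, r', v)) \<in> R \<union> R\<inverse>" using that by simp
    have "step u l r'"
      unfolding step_def
      by (rule exI[of _ "[]"], rule exI[of _ l], rule exI[of _ r'], rule exI[of _ "[]"])
        (use rel relation_parallel(5)[OF rel] in \<open>auto simp: awalk_Nil_iff\<close>)
    with relation_parallel(3,4)[OF rel] show ?thesis by (auto simp: r_def)
  qed
  ultimately have "(p, q) \<in> r u v"
    using cong_induct[OF assms] by blast
  then show ?thesis by (simp add: r_def)
qed

lemma steps_imp_rewrites:
  assumes "(step u)\<^sup>*\<^sup>* p q"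
  shows "\<exists>c. foldl (rewrite E L (\<nu> u)) (map \<eta> p) c = map \<eta> q"
  using assms
proof induction
  case base
  show ?case by (rule exI[of _ "[]"]) simp
next
  case (step q q')
  then obtain c where c: "foldl (rewrite E L (\<nu> u)) (map \<eta> p) c = map \<eta> q" by blast
  obtain a l r b x y where q: "q = a @ l @ b" "q' = a @ r @ b" and a: "awalk u a x"
      and rel: "((x, l, y), (x, r, y)) \<in> R \<union> R\<inverse>"
    using step(2) unfolding step_def by blast
  have "foldl (rewrite E L (\<nu> u)) (map \<eta> p) (c @ [(map \<eta> a, (\<nu> x, map \<eta> l, map \<eta> r), map \<eta> b)])
      = map \<eta> q'"
    using c set_L_I[OF rel] target_code[OF a] by (simp add: rewrite_def q)
  then show ?case by blast
qed

section \<open>Certificates of inequality\<close>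

lemma act_append: "act t s (p @ q) = act t (act t s p) q"
  by (simp add: act_def)

lemma act_Cons: "act t s (e # p) = act t (act t s [e]) p"
  by (simp add: act_def)

lemma model_act:
  assumes model: "model E L S t" and "awalk u p v" "s \<in> set S" "fst s = \<nu> u"
  shows "act t s (map \<eta> p) \<in> set S \<and> fst (act t s (map \<eta> p)) = \<nu> v"
  using assms(2-)
proof (induction p arbitrary: u s)
  case Nil
  then show ?case by (simp add: act_def awalk_Nil_iff)
next
  case (Cons e p)
  then have "(\<eta> e, \<nu> u, \<nu> (head X e)) \<in> set E"
    by (auto simp: set_E awalk_Cons_iff)
  with model Cons.prems(2,3)
  have "act t s [\<eta> e] \<in> set S" "fst (act t s [\<eta> e]) = \<nu> (head X e)"
    unfolding model_def by fastforce+
  with Cons.IH[of "head X e" "act t s [\<eta> e]"] Cons.prems(1) show ?case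
    using act_Cons[of t s "\<eta> e" "map \<eta> p"] by (simp add: awalk_Cons_iff)
qed

text \<open>Acting alike on all states over the start vertex is a congruence that contains the relations.\<close>
lemma model_respects_cong:
  assumes model: "model E L S t" and "(p, q) \<in> cong u v" "u \<in> verts X" "v \<in> verts X"
    and s: "s \<in> set S" "fst s = \<nu> u"
  shows "act t s (map \<eta> p) = act t s (map \<eta> q)"
proof -
  define r where "r u v = {(p, q). awalk u p v \<and> awalk u q v \<and>
    (\<forall>s\<in>set S. fst s = \<nu> u \<longrightarrow> act t s (map \<eta> p) = act t s (map \<eta> q))}" for u v
  have "equiv {p. awalk u p v} (r u v)" for u v
    by (rule equivI) (auto simp: r_def refl_on_def intro!: symI transI)
  moreover have "(p @ q, p' @ q') \<in> r u w" if "(p, p') \<in> r u v" "(q, q') \<in> r v w" for u v w p p' q q'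
    using that model_act[OF model] unfolding r_def by (auto simp: act_append intro: awalk_appendI)
  ultimately have "congruence (free_category X) r"
    unfolding congruence_def by simp
  moreover have "(l, r') \<in> r u v" if "((u, l, v), (u, r', v)) \<in> R" for u l v r'
  proof -
    have rel: "((u, l, v), (u, r', v)) \<in> R \<union> R\<inverse>" using that by simp
    with set_L_I[OF rel] model relation_parallel(3,4)[OF rel] show ?thesis
      unfolding r_def model_def by fastforce
  qed
  ultimately have "(p, q) \<in> r u v"
    using cong_induct[OF assms(2-4)] by blast
  with s show ?thesis by (simp add: r_def)
qed

text \<open>
  The states over \<open>w\<close> are the morphisms \<open>F u \<rightarrow> F w\<close> of \<open>D\<close>, and an edge acts by composition with its image
  under the functor; there are finitely many, because \<open>X\<close> and \<open>D\<close> are finite. Starting at the identity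
  of \<open>F u\<close>, a path leads to its own image.
\<close>
lemma functor_model:
  assumes D: "finite_category D" and G: "cat_functor (free_category X) D Fo G"
    and rel: "\<And>x l y r. ((x, l, y), (x, r, y)) \<in> R \<union> R\<inverse> \<Longrightarrow> G x y l = G x y r"
    and u: "u \<in> verts X"
  obtains S t s where "model E L S t" "s \<in> set S" "fst s = \<nu> u"
    "\<And>p v. awalk u p v \<Longrightarrow> act t s (map \<eta> p) = (\<nu> v, G u v p)"
proof -
  interpret D: finite_category D by (fact D)
  interpret G: cat_functor "free_category X" D Fo G by (fact G)
  have G_Mor: "G w w' p \<in> Mor D (Fo w) (Fo w')" if "awalk w p w'" for w w' p
    using G.Fm_in_Mor[of w w' p] that by (auto dest: awalk_hd_in_verts awalk_last_in_verts)
  have Fo: "Fo w \<in> Obj D" if "w \<in> verts X" for w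
    using G.Fo_in_Obj that by simp
  define next_state where "next_state e m =
    (\<nu> (head X e), Cmp D (Fo u) (Fo (tail X e)) (Fo (head X e)) m (G (tail X e) (head X e) [e]))" for e m
  have "finite ((\<lambda>(w, m). (\<nu> w, m)) ` (SIGMA w : verts X. Mor D (Fo u) (Fo w)))"
    using u Fo by (intro finite_imageI finite_SigmaI) (auto intro: D.finite_Mor)
  then obtain S where S: "set S = (\<lambda>(w, m). (\<nu> w, m)) ` (SIGMA w : verts X. Mor D (Fo u) (Fo w))"
    using finite_list by blast
  have "finite ((\<lambda>(e, m). (((\<nu> (tail X e), m), \<eta> e), next_state e m)) `
      (SIGMA e : arcs X. Mor D (Fo u) (Fo (tail X e))))"
    using u Fo by (intro finite_imageI finite_SigmaI) (auto intro: D.finite_Mor)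
  then obtain t where t: "set t = (\<lambda>(e, m). (((\<nu> (tail X e), m), \<eta> e), next_state e m)) `
      (SIGMA e : arcs X. Mor D (Fo u) (Fo (tail X e)))"
    using finite_list by blast
  have edge: "act t (\<nu> (tail X e), m) [\<eta> e] = next_state e m"
    if e: "e \<in> arcs X" and m: "m \<in> Mor D (Fo u) (Fo (tail X e))" for e m
  proof -
    have "lookup (\<nu> (tail X e), m) t ((\<nu> (tail X e), m), \<eta> e) = next_state e m"
    proof (rule lookup_eq)
      fix y assume "(((\<nu> (tail X e), m), \<eta> e), y) \<in> set t"
      then show "y = next_state e m"
        using inj_\<eta> e by (auto simp: t dest: inj_onD)
    qed (use e m in \<open>force simp: t\<close>)
    then show ?thesis by (simp add: act_def)
  qed
  have act: "act t (\<nu> w, m) (map \<eta> p) = (\<nu> w', Cmp D (Fo u) (Fo w) (Fo w') m (G w w' p))"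
    if "awalk w p w'" "m \<in> Mor D (Fo u) (Fo w)" for w w' p m
    using that
  proof (induction p arbitrary: w m)
    case Nil
    then have w: "w' = w" "w \<in> verts X"
      by (auto simp: awalk_Nil_iff)
    have "Cmp D (Fo u) (Fo w) (Fo w) m (G w w []) = m"
      using G.Fm_Idt[of w] D.Cmp_Idt_right[OF Fo[OF u] Fo[OF w(2)] Nil(2)] w by simp
    then show ?case by (simp add: act_def w)
  next
    case (Cons e p)
    from Cons.prems have e: "e \<in> arcs X" and w: "w = tail X e" and p: "awalk (head X e) p w'"
      by (auto simp: awalk_Cons_iff)
    have e': "awalk w [e] (head X e)"
      using arc_implies_awalk[OF e] w by simp
    have verts: "w \<in> verts X" "head X e \<in> verts X" "w' \<in> verts X"
      using e' p by (auto dest: awalk_hd_in_verts awalk_last_in_verts)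
    let ?m = "Cmp D (Fo u) (Fo w) (Fo (head X e)) m (G w (head X e) [e])"
    have "?m \<in> Mor D (Fo u) (Fo (head X e))"
      using Cons.prems(2) u verts Fo G_Mor[OF e'] by (intro D.Cmp_in_Mor) auto
    from Cons.IH[OF p this]
    have "act t (\<nu> w, m) (map \<eta> (e # p)) =
        (\<nu> w', Cmp D (Fo u) (Fo (head X e)) (Fo w') ?m (G (head X e) w' p))"
      using edge[OF e] Cons.prems(2) act_Cons[of t "(\<nu> w, m)" "\<eta> e" "map \<eta> p"]
      by (simp add: w next_state_def)
    also have "Cmp D (Fo u) (Fo (head X e)) (Fo w') ?m (G (head X e) w' p) =
        Cmp D (Fo u) (Fo w) (Fo w') m (Cmp D (Fo w) (Fo (head X e)) (Fo w') (G w (head X e) [e]) (G (head X e) w' p))"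
      using Cons.prems(2) u verts Fo G_Mor[OF e'] G_Mor[OF p] by (intro D.Cmp_assoc) auto
    also have "Cmp D (Fo w) (Fo (head X e)) (Fo w') (G w (head X e) [e]) (G (head X e) w' p) = G w w' (e # p)"
      using G.Fm_Cmp[of w "head X e" w' "[e]" p] verts e' p by simp
    finally show ?case .
  qed
  have S_E: "\<exists>w m. s = (\<nu> w, m) \<and> w \<in> verts X \<and> m \<in> Mor D (Fo u) (Fo w)" if "s \<in> set S" for s
    using that by (auto simp: S)
  have S_I: "(\<nu> w, m) \<in> set S" if "w \<in> verts X" "m \<in> Mor D (Fo u) (Fo w)" for w m
    using that by (force simp: S)
  show thesis
  proof (rule that)
    show "model E L S t"
      unfolding model_def
    proof (intro ballI conjI)
      fix s x assume "s \<in> set S" and "x \<in> set E"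
      from \<open>s \<in> set S\<close> obtain w m where s: "s = (\<nu> w, m)" "w \<in> verts X" "m \<in> Mor D (Fo u) (Fo w)"
        using S_E by blast
      from \<open>x \<in> set E\<close> obtain e
        where x: "x = (\<eta> e, \<nu> (tail X e), \<nu> (head X e))" and e: "e \<in> arcs X"
        unfolding set_E by blast
      show "case x of (e, a, b) \<Rightarrow> a = fst s \<longrightarrow> act t s [e] \<in> set S \<and> fst (act t s [e]) = b"
        unfolding x prod.case
      proof
        assume "\<nu> (tail X e) = fst s"
        then have w: "w = tail X e"
          using inj_\<nu> s e by (auto dest: inj_onD)
        have "Cmp D (Fo u) (Fo w) (Fo (head X e)) m (G w (head X e) [e]) \<in> Mor D (Fo u) (Fo (head X e))"
          using s e u w Fo G_Mor[OF arc_implies_awalk[OF e]] by (intro D.Cmp_in_Mor) auto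
        then show "act t s [\<eta> e] \<in> set S \<and> fst (act t s [\<eta> e]) = \<nu> (head X e)"
          using edge[OF e] s e w by (auto simp: next_state_def intro: S_I)
      qed
    next
      fix s x assume "s \<in> set S" and "x \<in> set L"
      then obtain w m where s: "s = (\<nu> w, m)" "w \<in> verts X" "m \<in> Mor D (Fo u) (Fo w)"
        using S_E by blast
      obtain z l y r where x: "x = (\<nu> z, map \<eta> l, map \<eta> r)" and R: "((z, l, y), (z, r, y)) \<in> R \<union> R\<inverse>"
        using \<open>x \<in> set L\<close> by (metis prod_cases3 set_L_E)
      show "case x of (v, l, r) \<Rightarrow> v = fst s \<longrightarrow> act t s l = act t s r"
        unfolding x prod.case
      proof
        assume "\<nu> z = fst s"
        then have "w = z"
          using inj_\<nu> s relation_parallel(5)[OF R] by (auto dest: inj_onD)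
        then show "act t s (map \<eta> l) = act t s (map \<eta> r)"
          using act[OF relation_parallel(3)[OF R]] act[OF relation_parallel(4)[OF R]] rel[OF R] s by simp
      qed
    qed
    show "(\<nu> u, Idt D (Fo u)) \<in> set S"
      using u D.Idt_in_Mor[OF Fo[OF u]] by (intro S_I)
    show "fst (\<nu> u, Idt D (Fo u)) = \<nu> u" by simp
    show "act t (\<nu> u, Idt D (Fo u)) (map \<eta> p) = (\<nu> v, G u v p)" if "awalk u p v" for p v
      using act[OF that D.Idt_in_Mor] u Fo G_Mor[OF that] awalk_last_in_verts[OF that]
      by (simp add: D.Cmp_Idt_left)
  qed
qed

lemma represented_arrow_eq_iff:
  assumes p: "awalk u p v" and q: "awalk u' q v'"
  shows "represented_arrow X R (u, p, v) = represented_arrow X R (u', q, v') \<longleftrightarrow>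
    u = u' \<and> v = v' \<and> (p, q) \<in> cong u v"
proof -
  have "cong u v `` {p} = cong u v `` {q} \<longleftrightarrow> (p, q) \<in> cong u v" if "u = u'" "v = v'"
    using that p q awalk_hd_in_verts[OF p] awalk_last_in_verts[OF p]
    by (intro eq_equiv_class_iff[OF equiv_cong]) auto
  then show ?thesis by (auto simp: represented_arrow_def)
qed

lemma proves_equal_iff:
  assumes p: "awalk u p v" and q: "awalk u' q v'"
  shows "(\<exists>c. proves_equal E L c ((\<nu> u, map \<eta> p), (\<nu> u', map \<eta> q))) \<longleftrightarrow>
    represented_arrow X R (u, p, v) = represented_arrow X R (u', q, v')"
    (is "?L \<longleftrightarrow> ?R")
proof
  have verts: "u \<in> verts X" "u' \<in> verts X" "v \<in> verts X"
    using p q by (auto dest: awalk_hd_in_verts awalk_last_in_verts)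
  assume ?L
  then obtain c where "\<nu> u = \<nu> u'" and c: "foldl (rewrite E L (\<nu> u)) (map \<eta> p) c = map \<eta> q"
    by (auto simp: proves_equal_def)
  then have u: "u = u'"
    using inj_\<nu> verts by (auto dest: inj_onD)
  obtain q' where q': "map \<eta> q = map \<eta> q'" "(p, q') \<in> cong u v"
    using rewrites_cong[OF p, of c] c by auto
  have "q = q'"
    using q'(1) map_\<eta>_inject awalk_arcs[OF q] awalk_arcs[OF cong_awalk[OF _ _ q'(2)]] verts by blast
  with u q' q show ?R
    using awalk_unique cong_awalk[OF _ _ q'(2)] verts unfolding represented_arrow_eq_iff[OF p q] by blast
next
  assume ?R
  then have "u = u'" "(p, q) \<in> cong u v"
    unfolding represented_arrow_eq_iff[OF p q] by auto
  then show ?L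
    using steps_imp_rewrites[OF cong_imp_steps, of p q u v] p
    by (auto simp: proves_equal_def dest: awalk_hd_in_verts awalk_last_in_verts)
qed

text \<open>
  If the ends of the paths differ, the paths arrive at states over different vertices, whatever the
  functor does to them. Otherwise the functor separates them as elements of one morphism set.
\<close>
lemma residually_finite_imp_separating_model:
  assumes rf: "residually_finite (presented_category X R)"
    and p: "awalk u p v" and q: "awalk u q v'" and ne: "\<not> (v = v' \<and> (p, q) \<in> cong u v)"
  obtains S t s where "model E L S t" "s \<in> set S" "fst s = \<nu> u" "act t s (map \<eta> p) \<noteq> act t s (map \<eta> q)"
proof -
  let ?Q = "presented_category X R"
  have verts: "u \<in> verts X" "v \<in> verts X" "v' \<in> verts X"
    using p q by (auto dest: awalk_hd_in_verts awalk_last_in_verts)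
  have "represented_arrow X R (u, p, v) \<in> arrows ?Q" "represented_arrow X R (u, q, v') \<in> arrows ?Q"
    using verts p q
    by (auto simp: represented_arrow_def arrows_def presented_category_def quotient_category_def
        intro: quotientI)
  moreover have "represented_arrow X R (u, p, v) \<noteq> represented_arrow X R (u, q, v')"
    using ne by (simp add: represented_arrow_eq_iff[OF p q])
  ultimately obtain D :: "(nat, nat) cat" and Fo Fm where D: "finite_category D"
      and F: "cat_functor ?Q D Fo Fm"
      and F_ne: "map_arrow Fo Fm (represented_arrow X R (u, p, v)) \<noteq>
        map_arrow Fo Fm (represented_arrow X R (u, q, v'))"
    using rf unfolding residually_finite_def by blast
  interpret F: cat_functor ?Q D Fo Fm by (fact F)
  interpret P: cat_functor "free_category X" ?Q "\<lambda>w. w" "\<lambda>w w' p. cong w w' `` {p}"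
    unfolding presented_category_def
    by (rule quotient_category_category(2)[OF category_free congruence_cong])
  define G where "G w w' p = Fm w w' (cong w w' `` {p})" for w w' p
  have "cat_functor (free_category X) D Fo G"
    unfolding G_def
    by unfold_locales
      (use P.Fo_in_Obj P.Fm_in_Mor P.Fm_Idt P.Fm_Cmp F.Fo_in_Obj F.Fm_in_Mor F.Fm_Idt F.Fm_Cmp in \<open>simp_all\<close>)
  moreover have "G x y l = G x y r" if "((x, l, y), (x, r, y)) \<in> R \<union> R\<inverse>" for x l y r
    using equiv_class_eq[OF equiv_cong cong_relation[OF that]] relation_parallel(5,6)[OF that]
    by (simp add: G_def)
  ultimately obtain S t s where m: "model E L S t" "s \<in> set S" "fst s = \<nu> u"
      and act: "\<And>p v. awalk u p v \<Longrightarrow> act t s (map \<eta> p) = (\<nu> v, G u v p)"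
    using functor_model[OF D _ _ verts(1)] by blast
  have "v = v' \<Longrightarrow> G u v p \<noteq> G u v' q"
    using F_ne by (auto simp: G_def represented_arrow_def)
  then have "act t s (map \<eta> p) \<noteq> act t s (map \<eta> q)"
    using inj_\<nu> verts by (auto simp: act[OF p] act[OF q] dest: inj_onD)
  with m show thesis by (rule that)
qed

lemma proves_unequal_iff:
  assumes rf: "residually_finite (presented_category X R)"
    and p: "awalk u p v" and q: "awalk u' q v'"
  shows "(\<exists>d. proves_unequal E L d ((\<nu> u, map \<eta> p), (\<nu> u', map \<eta> q))) \<longleftrightarrow>
    represented_arrow X R (u, p, v) \<noteq> represented_arrow X R (u', q, v')"
    (is "?L \<longleftrightarrow> ?R")
proof
  assume ?L
  then obtain S t s where d: "proves_unequal E L (S, t, s) ((\<nu> u, map \<eta> p), (\<nu> u', map \<eta> q))"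
    by (metis prod_cases3)
  show ?R
  proof
    assume "represented_arrow X R (u, p, v) = represented_arrow X R (u', q, v')"
    then have "u = u'" "(p, q) \<in> cong u v"
      unfolding represented_arrow_eq_iff[OF p q] by auto
    then show False
      using d model_respects_cong[of S t p q u v s] awalk_hd_in_verts[OF p] awalk_last_in_verts[OF p]
      by (auto simp: proves_unequal_def)
  qed
next
  assume ne: ?R
  show ?L
  proof (cases "u = u'")
    case True
    with ne have "\<not> (v = v' \<and> (p, q) \<in> cong u v)"
      unfolding represented_arrow_eq_iff[OF p q] by simp
    with residually_finite_imp_separating_model[OF rf p] q True
    obtain S t s where "model E L S t" "s \<in> set S" "fst s = \<nu> u" "act t s (map \<eta> p) \<noteq> act t s (map \<eta> q)"
      by metis
    then have "proves_unequal E L (S, t, s) ((\<nu> u, map \<eta> p), (\<nu> u', map \<eta> q))"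
      by (simp add: proves_unequal_def)
    then show ?thesis by blast
  next
    case False
    then have "\<nu> u \<noteq> \<nu> u'"
      using inj_\<nu> p q by (auto dest: inj_onD awalk_hd_in_verts)
    then show ?thesis by (auto simp: proves_unequal_def)
  qed
qed

end

section \<open>The word problem\<close>

theorem theorem5p2:
  fixes X :: "('v, 'e) pre_digraph"
    and R :: "(('v, 'e) path \<times> ('v, 'e) path) set"
  assumes "finite_presentation X R"
    and "residually_finite (presented_category X R)"
  shows "word_problem_solvable X R"
  unfolding word_problem_solvable_def
proof (intro allI impI, elim conjE)
  fix \<nu> :: "'v \<Rightarrow> nat" and \<eta> :: "'e \<Rightarrow> nat"
  assume inj: "inj_on \<nu> (verts X)" "inj_on \<eta> (arcs X)"
  interpret fin_digraph X
    using assms(1) by (simp add: finite_presentation_def)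
  have "finite ((\<lambda>e. (\<eta> e, \<nu> (tail X e), \<nu> (head X e))) ` arcs X)"
    by simp
  then obtain E where E: "set E = (\<lambda>e. (\<eta> e, \<nu> (tail X e), \<nu> (head X e))) ` arcs X"
    using finite_list by blast
  have "finite ((\<lambda>((u, l, v), (u', r, v')). (\<nu> u, map \<eta> l, map \<eta> r)) ` (R \<union> R\<inverse>))"
    using assms(1) by (simp add: finite_presentation_def)
  then obtain L where L: "set L = (\<lambda>((u, l, v), (u', r, v')). (\<nu> u, map \<eta> l, map \<eta> r)) ` (R \<union> R\<inverse>)"
    using finite_list by blast
  interpret coded_presentation X R \<nu> \<eta> E L
    by unfold_locales (fact assms(1) inj E L)+
  obtain alg where alg: "\<And>x. (\<exists>c. proves_equal E L c x) \<noteq> (\<exists>d. proves_unequal E L d x) \<Longrightarrow>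
      computes alg [encode x] (of_bool (\<exists>c. proves_equal E L c x))"
    using semidecidable_alternatives_algorithm[OF decidable_proves_equal decidable_proves_unequal] by blast
  have "computes (Comp alg [pair_alg]) [path_code \<nu> \<eta> p, path_code \<nu> \<eta> q]
      (if represented_arrow X R p = represented_arrow X R q then 1 else 0)"
    if "p \<in> arrows (free_category X)" "q \<in> arrows (free_category X)" for p q
  proof -
    obtain u p' v u' q' v' where pq: "p = (u, p', v)" "q = (u', q', v')" "awalk u p' v" "awalk u' q' v'"
      using \<open>p \<in> _\<close> \<open>q \<in> _\<close> by (auto simp: arrows_def)
    let ?x = "((\<nu> u, map \<eta> p'), (\<nu> u', map \<eta> q'))"
    have code: "encode ?x = prod_encode (path_code \<nu> \<eta> p, path_code \<nu> \<eta> q)"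
      by (simp add: encode_prod_def encode_list_def encode_nat_def pq comp_def)
    have "computes alg [encode ?x] (of_bool (represented_arrow X R p = represented_arrow X R q))"
      using alg[of ?x]
      unfolding proves_equal_iff[OF pq(3,4)] proves_unequal_iff[OF assms(2) pq(3,4)] pq(1,2)
      by blast
    then show ?thesis
      unfolding code by (intro computes_Comp1[OF computes_pair]) (simp add: of_bool_def)
  qed
  then show "\<exists>alg. \<forall>p \<in> arrows (free_category X). \<forall>q \<in> arrows (free_category X).
      computes alg [path_code \<nu> \<eta> p, path_code \<nu> \<eta> q]
        (if represented_arrow X R p = represented_arrow X R q then 1 else 0)"
    by blast
qed

end
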